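(* Let $n$ be a positive integer, and consider static data structures in the cell-probe model with word size $w=\Theta(\log n)$ bits that store an arbitrary $n$-vertex interval graph $G$ given in universal interval representation. Suppose such a data structure uses $\log_2(n!)+r$ bits of space, answers every adjacency query $\mathrm{adj}(u,v)$ with at most $t_1$ cell probes, and answers every degree query $\deg(v)$ with at most $t_2$ cell probes. Then \[ r \ge \frac{n}{(\log n)^{O(t_1+t_2)}}. \]
   Context: An interval graph $G=(V,E)$ is a graph with an interval $I_v$ of the real line for each vertex $v$ such that $u,v$ are adjacent iff $I_u\cap I_v\neq\emptyset$; the set $\{I_v\}$ is an interval representation. A universal interval representation of an $n$-vertex interval graph is an interval representation in which every $i\in[n]=\{1,\dots,n\}$ is the left endpoint of exactly one interval; vertex $i$ is identified with the interval $I_i=[i,e_i]$ with integer $e_i\in[i,n]$ (so there are $n!$ possible inputs). $\mathrm{adj}(u,v)$ returns whether $u,v$ are adjacent; $\deg(v)$ returns the number of neighbours of $v$. In the cell-probe model, a preprocessing algorithm with unlimited computational power maps the input to a table of cells of $w$ bits each; a query algorithm with unlimited computational power answers a query by adaptively reading cells (each choice of the next cell may depend on the contents read so far), and its cost is the number of cells read. The data structure must use the vertex labels of the universal interval representation (no relabelling). *)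

theory Defs
  imports Complex_Main "HOL-Library.FuncSet" "HOL-Library.Landau_Symbols"
begin

section \<open>Interval graphs in universal interval representation\<close>

text \<open>
  A universal interval representation on the vertices \<open>1, \<dots>, n\<close> is given by the integer right
  endpoints \<open>e i \<in> {i..n}\<close>; vertex \<open>i\<close> is the interval \<open>[i, e i]\<close>. Functions are extensional, so
  that different functions are different inputs.
\<close>

definition universal_reps :: "nat \<Rightarrow> (nat \<Rightarrow> nat) set" where
  "universal_reps n = (\<Pi>\<^sub>E i\<in>{1..n}. {i..n})"

definition vertex_interval :: "(nat \<Rightarrow> nat) \<Rightarrow> nat \<Rightarrow> real set" where
  "vertex_interval e i = {real i .. real (e i)}"

definition adj :: "(nat \<Rightarrow> nat) \<Rightarrow> nat \<Rightarrow> nat \<Rightarrow> bool" where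
  "adj e u v \<longleftrightarrow> u \<noteq> v \<and> vertex_interval e u \<inter> vertex_interval e v \<noteq> {}"

definition deg :: "nat \<Rightarrow> (nat \<Rightarrow> nat) \<Rightarrow> nat \<Rightarrow> nat" where
  "deg n e v = card {u \<in> {1..n}. adj e v u}"

lemma card_universal_reps: "card (universal_reps n) = fact n"
proof -
  have "card (universal_reps n) = (\<Prod>i\<in>{1..n}. Suc n - i)"
    unfolding universal_reps_def by (subst card_PiE) auto
  also have "\<dots> = \<Prod>{1..n}"
    by (rule prod.reindex_bij_witness[of _ "\<lambda>i. Suc n - i" "\<lambda>i. Suc n - i"]) auto
  finally show ?thesis by (simp add: fact_prod)
qed


section \<open>The cell-probe model\<close>

type_synonym word = "bool list"

text \<open>The memory contents consisting of \<open>s\<close> cells of \<open>w\<close> bits each.\<close>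

definition tables :: "nat \<Rightarrow> nat \<Rightarrow> word list set" where
  "tables s w = {T. length T = s \<and> (\<forall>c\<in>set T. length c = w)}"

text \<open>
  An adaptive query algorithm without any computational restriction is a decision tree: it either
  halts with an answer, or names the address of a cell and continues depending on its contents.
\<close>

datatype 'a query_alg = Answer 'a | Probe nat "word \<Rightarrow> 'a query_alg"

primrec result :: "'a query_alg \<Rightarrow> word list \<Rightarrow> 'a" where
  "result (Answer a) T = a"
| "result (Probe i k) T = result (k (T ! i)) T"

primrec probes :: "'a query_alg \<Rightarrow> word list \<Rightarrow> nat list" where
  "probes (Answer a) T = []"
| "probes (Probe i k) T = i # probes (k (T ! i)) T"

definition answers_within :: "'a query_alg \<Rightarrow> word list \<Rightarrow> 'a \<Rightarrow> nat \<Rightarrow> bool" where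
  "answers_within Q T a t \<longleftrightarrow>
     set (probes Q T) \<subseteq> {..<length T} \<and> result Q T = a \<and> length (probes Q T) \<le> t"

definition interval_graph_structure ::
  "nat \<Rightarrow> nat \<Rightarrow> nat \<Rightarrow> nat \<Rightarrow> nat \<Rightarrow> ((nat \<Rightarrow> nat) \<Rightarrow> word list) \<Rightarrow>
   (nat \<Rightarrow> nat \<Rightarrow> bool query_alg) \<Rightarrow> (nat \<Rightarrow> nat query_alg) \<Rightarrow> bool" where
  "interval_graph_structure n w s t1 t2 enc adj_alg deg_alg \<longleftrightarrow>
     (\<forall>e\<in>universal_reps n.
        enc e \<in> tables s w \<and>
        (\<forall>u\<in>{1..n}. \<forall>v\<in>{1..n}. answers_within (adj_alg u v) (enc e) (adj e u v) t1) \<and>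
        (\<forall>v\<in>{1..n}. answers_within (deg_alg v) (enc e) (deg n e v) t2))"

end

theory Submission
  imports Defs
begin

text \<open>
  Since \<open>deg v = e v - 1 - R v\<close>, where \<open>R v\<close> is the number of intervals that end before \<open>v\<close>, one
  degree query and binary search with adjacency queries compute \<open>R v\<close>, while the answer to the degree
  query together with two adjacency queries at \<open>e v\<close> and \<open>e v + 1\<close> certifies it. The cells probed by
  such a certificate form the footprint of \<open>v\<close>.

  Call a cell \<open>q\<close>-popular if it lies in at least \<open>n / q\<close> footprints. As footprints have
  \<open>O(t\<^sub>1 + t\<^sub>2)\<close> cells, among \<open>O(t\<^sub>1 + t\<^sub>2)\<close> polylogarithmically spaced levels there is one level \<open>q\<close> such that
  few footprints meet the cells which are popular on the next level, but not on level \<open>q\<close>. Publish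
  the \<open>q\<close>-popular cells with their contents, and keep the inputs of a most frequent publication.
  Two of their tables that differ in \<open>q\<close> times polylogarithmically many cells then agree on most
  footprints, so they have the same \<open>R v\<close> for most \<open>v\<close>.

  On the other hand, let the ranks of the middles of \<open>k = q\<close> times polylogarithmically many blocks be
  read from one table, and write this transcript over another one. If the redundancy is below \<open>q\<close>, there
  is a background on which many transcripts yield valid tables; they differ in few cells, but the
  anticoncentration of the ranks prevents them from having nearly equal ranks everywhere.
\<close>

section \<open>Ranks of right endpoints\<close>

definition endrank :: "nat \<Rightarrow> (nat \<Rightarrow> nat) \<Rightarrow> nat \<Rightarrow> nat" where
  "endrank n e v = card {u \<in> {1..n}. e u < v}"

lemma universal_repsD:
  assumes "e \<in> universal_reps n" "u \<in> {1..n}"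
  shows "u \<le> e u" "e u \<le> n"
  using assms by (auto simp: universal_reps_def dest: PiE_mem)

lemma finite_universal_reps: "finite (universal_reps n)"
  by (simp add: universal_reps_def finite_PiE)

lemma adj_iff:
  assumes "e \<in> universal_reps n" "u \<in> {1..n}" "v \<in> {1..n}"
  shows "adj e u v \<longleftrightarrow> u \<noteq> v \<and> v \<le> e u \<and> u \<le> e v"
proof -
  have "vertex_interval e u \<inter> vertex_interval e v = {real (max u v) .. real (min (e u) (e v))}"
    by (auto simp: vertex_interval_def)
  then have "vertex_interval e u \<inter> vertex_interval e v \<noteq> {} \<longleftrightarrow> max u v \<le> min (e u) (e v)"
    by (auto simp del: of_nat_max of_nat_min simp add: not_less)
  with universal_repsD[OF assms(1,2)] universal_repsD[OF assms(1,3)] show ?thesis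
    by (auto simp: adj_def)
qed

text \<open>A neighbour of \<open>v\<close> either starts after \<open>v\<close> and up to
  \<open>e v\<close>, or starts earlier and reaches \<open>v\<close>. The earlier vertices that fail
  to reach \<open>v\<close> are exactly those counted by \<open>endrank\<close>, since an endpoint
  below \<open>v\<close> forces a start below \<open>v\<close>.\<close>

lemma deg_endrank:
  assumes e: "e \<in> universal_reps n" and v: "v \<in> {1..n}"
  shows "deg n e v + endrank n e v + 1 = e v"
proof -
  have vb: "v \<le> e v" "e v \<le> n" using universal_repsD[OF e v] by auto
  have "{u \<in> {1..n}. adj e v u} = {v<..e v} \<union> {u \<in> {1..<v}. v \<le> e u}"
  proof (intro set_eqI iffI)
    fix u assume "u \<in> {u \<in> {1..n}. adj e v u}"
    then show "u \<in> {v<..e v} \<union> {u \<in> {1..<v}. v \<le> e u}"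
      using adj_iff[OF e v, of u] v by auto
  next
    fix u assume u: "u \<in> {v<..e v} \<union> {u \<in> {1..<v}. v \<le> e u}"
    then have "u \<in> {1..n}" using v vb by auto
    with u show "u \<in> {u \<in> {1..n}. adj e v u}"
      using adj_iff[OF e v, of u] universal_repsD[OF e, of u] vb by auto
  qed
  then have "deg n e v = card ({v<..e v} \<union> {u \<in> {1..<v}. v \<le> e u})"
    by (simp only: deg_def)
  also have "\<dots> = card {v<..e v} + card {u \<in> {1..<v}. v \<le> e u}"
    by (rule card_Un_disjoint) auto
  finally have "deg n e v = card {v<..e v} + card {u \<in> {1..<v}. v \<le> e u}" .
  moreover have "{u \<in> {1..n}. e u < v} = {u \<in> {1..<v}. e u < v}"
  proof (intro set_eqI iffI)
    fix u assume "u \<in> {u \<in> {1..n}. e u < v}"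
    then show "u \<in> {u \<in> {1..<v}. e u < v}"
      using universal_repsD(1)[OF e, of u] by auto
  qed (use v in auto)
  moreover have "card {u \<in> {1..<v}. v \<le> e u} + card {u \<in> {1..<v}. e u < v} = card {1..<v}"
    by (subst card_Un_disjoint[symmetric]) (auto intro!: arg_cong[where f = card] simp del: card_atLeastLessThan)
  ultimately show ?thesis
    using v vb by (simp add: endrank_def)
qed


section \<open>Composing query algorithms\<close>

primrec bind_alg :: "'a query_alg \<Rightarrow> ('a \<Rightarrow> 'b query_alg) \<Rightarrow> 'b query_alg" where
  "bind_alg (Answer a) g = g a"
| "bind_alg (Probe i k) g = Probe i (\<lambda>c. bind_alg (k c) g)"

lemma result_bind_alg: "result (bind_alg Q g) T = result (g (result Q T)) T"
  by (induction Q) auto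

lemma probes_bind_alg: "probes (bind_alg Q g) T = probes Q T @ probes (g (result Q T)) T"
  by (induction Q) auto

lemma query_alg_cong:
  assumes "\<And>i. i \<in> set (probes Q T) \<Longrightarrow> T ! i = T' ! i"
  shows "probes Q T' = probes Q T \<and> result Q T' = result Q T"
  using assms by (induction Q) auto

text \<open>Binary search with the invariant \<open>lo \<le> e v < lo + 2 ^ d\<close>; for
  \<open>x > v\<close> the adjacency query \<open>A x\<close> asks whether
  \<open>x \<le> e v\<close>. The test against \<open>n\<close> avoids queries at non-vertices,
  whose answers are unspecified.\<close>

primrec endpoint_search ::
  "nat \<Rightarrow> (nat \<Rightarrow> bool query_alg) \<Rightarrow> nat \<Rightarrow> nat \<Rightarrow> nat query_alg" where
  "endpoint_search n A 0 lo = Answer lo"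
| "endpoint_search n A (Suc d) lo =
     (if lo + 2 ^ d \<le> n
      then bind_alg (A (lo + 2 ^ d))
        (\<lambda>b. if b then endpoint_search n A d (lo + 2 ^ d) else endpoint_search n A d lo)
      else endpoint_search n A d lo)"

lemma endpoint_search_correct:
  assumes "\<And>x. v < x \<Longrightarrow> x \<le> n \<Longrightarrow> answers_within (A x) T (x \<le> y) t"
    and "v \<le> lo" "lo \<le> y" "y < lo + 2 ^ d" "y \<le> n"
  shows "answers_within (endpoint_search n A d lo) T y (d * t)"
  using assms(2-)
proof (induction d arbitrary: lo)
  case 0
  then show ?case by (simp add: answers_within_def)
next
  case (Suc d)
  have step: "answers_within (endpoint_search n A d lo') T y (d * t)"
    if "v \<le> lo'" "lo' \<le> y" "y < lo' + 2 ^ d" for lo'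
    using Suc.IH that Suc.prems(4) by blast
  show ?case
  proof (cases "lo + 2 ^ d \<le> n")
    case True
    then have A: "answers_within (A (lo + 2 ^ d)) T (lo + 2 ^ d \<le> y) t"
      by (intro assms(1)) (use Suc.prems(1) zero_less_power[of "2::nat" d] in linarith)+
    show ?thesis
    proof (cases "lo + 2 ^ d \<le> y")
      case True
      then show ?thesis
        using A step[of "lo + 2 ^ d"] Suc.prems \<open>lo + 2 ^ d \<le> n\<close>
        by (simp add: answers_within_def result_bind_alg probes_bind_alg)
    next
      case False
      then show ?thesis
        using A step[of lo] Suc.prems \<open>lo + 2 ^ d \<le> n\<close>
        by (simp add: answers_within_def result_bind_alg probes_bind_alg)
    qed
  next
    case False
    then have "answers_within (endpoint_search n A d lo) T y (d * t)"
      using step[of lo] Suc.prems by simp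
    then show ?thesis
      using False by (simp add: answers_within_def)
  qed
qed

section \<open>Rank queries and their certificates\<close>

definition rank_alg ::
  "nat \<Rightarrow> nat \<Rightarrow> (nat \<Rightarrow> nat \<Rightarrow> bool query_alg) \<Rightarrow> (nat \<Rightarrow> nat query_alg) \<Rightarrow> nat \<Rightarrow> nat query_alg" where
  "rank_alg n d adj_alg deg_alg v =
     bind_alg (deg_alg v) (\<lambda>x. bind_alg (endpoint_search n (adj_alg v) d v) (\<lambda>y. Answer (y - 1 - x)))"

text \<open>By \<open>deg_endrank\<close> the rank is \<open>e v - 1\<close> minus the degree.
  Searching for \<open>e v\<close> costs the factor \<open>d\<close>, which a footprint
  avoids.\<close>

lemma rank_alg_correct:
  assumes S: "interval_graph_structure n w s t1 t2 enc adj_alg deg_alg"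
    and e: "e \<in> universal_reps n" and v: "v \<in> {1..n}" and d: "n \<le> 2 ^ d"
  shows "answers_within (rank_alg n d adj_alg deg_alg v) (enc e) (endrank n e v) (t2 + d * t1)"
proof -
  have D: "answers_within (deg_alg v) (enc e) (deg n e v) t2"
    using S e v by (simp add: interval_graph_structure_def)
  have "answers_within (adj_alg v x) (enc e) (x \<le> e v) t1" if "v < x" "x \<le> n" for x
  proof -
    have x: "x \<in> {1..n}" using that v by auto
    have "adj e v x \<longleftrightarrow> x \<le> e v"
      using that adj_iff[OF e v x] universal_repsD[OF e x] by auto
    moreover have "answers_within (adj_alg v x) (enc e) (adj e v x) t1"
      using S e v x by (simp add: interval_graph_structure_def)
    ultimately show ?thesis by simp
  qed
  then have "answers_within (endpoint_search n (adj_alg v) d v) (enc e) (e v) (d * t1)"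
    using universal_repsD[OF e v] v d by (intro endpoint_search_correct[where v = v]) auto
  with D deg_endrank[OF e v] show ?thesis
    by (simp add: answers_within_def rank_alg_def result_bind_alg probes_bind_alg)
qed

text \<open>A nondeterministic certificate: its queries depend on the true value \<open>e v\<close>,
  which is verified and not searched for. This keeps its size, and with it the number of popularity
  levels, linear in \<open>t1 + t2\<close>. If \<open>e v = n\<close>, no upper bound on
  \<open>e v\<close> has to be verified.\<close>

definition footprint ::
  "nat \<Rightarrow> ((nat \<Rightarrow> nat) \<Rightarrow> word list) \<Rightarrow> (nat \<Rightarrow> nat \<Rightarrow> bool query_alg) \<Rightarrow> (nat \<Rightarrow> nat query_alg) \<Rightarrow>
   (nat \<Rightarrow> nat) \<Rightarrow> nat \<Rightarrow> nat set" where
  "footprint n enc adj_alg deg_alg e v =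
     set (probes (deg_alg v) (enc e)) \<union> set (probes (adj_alg v (e v)) (enc e)) \<union>
     (if e v < n then set (probes (adj_alg v (Suc (e v))) (enc e)) else {})"

lemma footprint_bounds:
  assumes S: "interval_graph_structure n w s t1 t2 enc adj_alg deg_alg"
    and e: "e \<in> universal_reps n" and v: "v \<in> {1..n}"
  shows "footprint n enc adj_alg deg_alg e v \<subseteq> {..<s}"
    and "card (footprint n enc adj_alg deg_alg e v) \<le> 2 * (t1 + t2)"
proof -
  have len: "length (enc e) = s"
    using S e by (auto simp: interval_graph_structure_def tables_def)
  have D: "answers_within (deg_alg v) (enc e) (deg n e v) t2"
    using S e v by (simp add: interval_graph_structure_def)
  have A: "answers_within (adj_alg v x) (enc e) (adj e v x) t1" if "x \<in> {1..n}" for x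
    using S e v that by (simp add: interval_graph_structure_def)
  have ev: "e v \<in> {1..n}" "e v < n \<Longrightarrow> Suc (e v) \<in> {1..n}"
    using universal_repsD[OF e v] v by auto
  show "footprint n enc adj_alg deg_alg e v \<subseteq> {..<s}"
    using D A[OF ev(1)] A[OF ev(2)] len by (auto simp: footprint_def answers_within_def)
  have c: "card (set (probes (deg_alg v) (enc e))) \<le> t2"
    "card (set (probes (adj_alg v (e v)) (enc e))) \<le> t1"
    "card (if e v < n then set (probes (adj_alg v (Suc (e v))) (enc e)) else {}) \<le> t1"
    using D A[OF ev(1)] A[OF ev(2)]
    by (auto simp: answers_within_def intro: card_length[THEN order_trans])
  have "card (footprint n enc adj_alg deg_alg e v) \<le> t2 + t1 + t1"
    unfolding footprint_def by (intro order_trans[OF card_Un_le] add_mono c)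
  then show "card (footprint n enc adj_alg deg_alg e v) \<le> 2 * (t1 + t2)"
    by simp
qed

text \<open>Agreement on the footprint replays the same probes on both tables. The query at
  \<open>e v\<close> gives \<open>e v \<le> e' v\<close> (automatic if \<open>e v = v\<close>), the
  negative answer at \<open>Suc (e v)\<close> gives \<open>e' v \<le> e v\<close>, and equal degrees
  then give equal ranks.\<close>

lemma footprint_certificate:
  assumes S: "interval_graph_structure n w s t1 t2 enc adj_alg deg_alg"
    and e: "e \<in> universal_reps n" and e': "e' \<in> universal_reps n" and v: "v \<in> {1..n}"
    and agree: "\<And>c. c \<in> footprint n enc adj_alg deg_alg e v \<Longrightarrow> enc e ! c = enc e' ! c"
  shows "e v = e' v" and "endrank n e v = endrank n e' v"
proof -
  have res: "result (deg_alg v) (enc f) = deg n f v"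
    "\<And>x. x \<in> {1..n} \<Longrightarrow> result (adj_alg v x) (enc f) = adj f v x"
    if "f \<in> universal_reps n" for f
    using S v that by (auto simp: interval_graph_structure_def answers_within_def)
  have ev: "e v \<in> {1..n}" "e v < n \<Longrightarrow> Suc (e v) \<in> {1..n}"
    using universal_repsD[OF e v] v by auto
  have d: "deg n e v = deg n e' v"
    using query_alg_cong[of "deg_alg v" "enc e" "enc e'"] agree res(1)[OF e] res(1)[OF e']
    by (auto simp: footprint_def)
  have a: "adj e v (e v) = adj e' v (e v)"
    using query_alg_cong[of "adj_alg v (e v)" "enc e" "enc e'"] agree
      res(2)[OF e ev(1)] res(2)[OF e' ev(1)]
    by (auto simp: footprint_def)
  have b: "adj e v (Suc (e v)) = adj e' v (Suc (e v))" if "e v < n"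
    using query_alg_cong[of "adj_alg v (Suc (e v))" "enc e" "enc e'"] agree that
      res(2)[OF e ev(2)] res(2)[OF e' ev(2)]
    by (auto simp: footprint_def)
  have "e v \<le> e' v"
    using a adj_iff[OF e v ev(1)] adj_iff[OF e' v ev(1)] universal_repsD[OF e v]
      universal_repsD[OF e' v] universal_repsD[OF e ev(1)]
    by (cases "e v = v") auto
  moreover have "e' v \<le> e v"
  proof (cases "e v < n")
    case True
    have "\<not> adj e v (Suc (e v))" "Suc (e v) \<noteq> v"
      using adj_iff[OF e v ev(2)[OF True]] universal_repsD[OF e v] by auto
    with b[OF True] have "\<not> Suc (e v) \<le> e' v"
      using adj_iff[OF e' v ev(2)[OF True]] universal_repsD[OF e v]
        universal_repsD[OF e' ev(2)[OF True]] by auto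
    then show ?thesis by simp
  qed (use universal_repsD[OF e' v] in simp)
  ultimately show "e v = e' v" by simp
  with d deg_endrank[OF e v] deg_endrank[OF e' v] show "endrank n e v = endrank n e' v"
    by simp
qed

lemma structure_inj_on:
  assumes S: "interval_graph_structure n w s t1 t2 enc adj_alg deg_alg"
  shows "inj_on enc (universal_reps n)"
proof (rule inj_onI)
  fix e e' assume e: "e \<in> universal_reps n" "e' \<in> universal_reps n" "enc e = enc e'"
  then have "e v = e' v" if "v \<in> {1..n}" for v
    using footprint_certificate(1)[OF S e(1,2) that] by simp
  with e(1,2) show "e = e'"
    unfolding universal_reps_def by (intro PiE_ext) auto
qed


section \<open>Rerouting memory contents\<close>

lemma card_tables: "card (tables s w) = 2 ^ (s * w)" and finite_tables: "finite (tables s w)"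
proof -
  have eq: "tables s w = {T. set T \<subseteq> {c. set c \<subseteq> UNIV \<and> length c = w} \<and> length T = s}"
    by (auto simp: tables_def)
  have fin: "finite {c. set c \<subseteq> (UNIV :: bool set) \<and> length c = w}"
    by (rule finite_lists_length_eq) simp
  show "finite (tables s w)"
    unfolding eq by (rule finite_lists_length_eq[OF fin])
  show "card (tables s w) = 2 ^ (s * w)"
    unfolding eq card_lists_length_eq[OF fin]
    using card_lists_length_eq[of "UNIV :: bool set" w]
    by (simp add: power_mult[symmetric] mult.commute)
qed

definition overwrite :: "nat set \<Rightarrow> 'a list \<Rightarrow> 'a list \<Rightarrow> 'a list" where
  "overwrite F T U = map (\<lambda>i. if i \<in> F then U ! i else T ! i) [0..<length T]"

lemma overwrite_nth [simp]:
  "i < length T \<Longrightarrow> overwrite F T U ! i = (if i \<in> F then U ! i else T ! i)"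
  by (simp add: overwrite_def)

lemma overwrite_in_tables:
  assumes "T \<in> tables s w" "U \<in> tables s w"
  shows "overwrite F T U \<in> tables s w"
  using assms by (auto simp: tables_def overwrite_def)

text \<open>Greedy packing: an element is added when its set misses all sets chosen so far. The
  covering clause excludes empty sets, which do not even meet themselves.\<close>

lemma maximal_disjoint_subfamily:
  assumes "finite A"
  shows "\<exists>Z\<subseteq>A. (\<forall>x\<in>Z. \<forall>y\<in>Z. x \<noteq> y \<longrightarrow> B x \<inter> B y = {}) \<and>
    (\<forall>x\<in>A. B x \<noteq> {} \<longrightarrow> (\<exists>z\<in>Z. B x \<inter> B z \<noteq> {}))"
  using assms
proof induction
  case empty
  then show ?case by simp
next
  case (insert a A)
  then obtain Z where Z: "Z \<subseteq> A" "\<forall>x\<in>Z. \<forall>y\<in>Z. x \<noteq> y \<longrightarrow> B x \<inter> B y = {}"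
    "\<forall>x\<in>A. B x \<noteq> {} \<longrightarrow> (\<exists>z\<in>Z. B x \<inter> B z \<noteq> {})"
    by (elim exE conjE)
  show ?case
  proof (cases "\<exists>z\<in>Z. B a \<inter> B z \<noteq> {}")
    case True
    with Z show ?thesis by (intro exI[of _ Z]) blast
  next
    case False
    then have "\<forall>z\<in>Z. B a \<inter> B z = {} \<and> B z \<inter> B a = {}" by blast
    with Z show ?thesis by (intro exI[of _ "insert a Z"]) (simp add: subset_insertI2)
  qed
qed

text \<open>
  A transcript read from one table can be written over another one. Pairs of a valid table and an
  arbitrary one correspond injectively to pairs of a background \<open>P\<close> and a table \<open>Q\<close> whose
  transcript is imposed on \<open>P\<close>; so some values of \<open>X\<close> are taken by many \<open>Q\<close>, unless few backgrounds
  admit many transcripts. A maximal packing by disjoint balls limits the number of the former values.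
\<close>

lemma rerouting_bound:
  fixes X :: "word list \<Rightarrow> 'x" and near :: "'x \<Rightarrow> 'x \<Rightarrow> bool"
  assumes V: "V \<subseteq> tables s w"
    and F: "\<And>M. M \<in> V \<Longrightarrow> F M \<subseteq> {..<s}"
    and closed: "\<And>M Q. M \<in> V \<Longrightarrow> Q \<in> tables s w \<Longrightarrow> (\<And>i. i \<in> F M \<Longrightarrow> M ! i = Q ! i) \<Longrightarrow>
       F Q = F M \<and> X Q = X M"
    and refl: "\<And>x. near x x" and sym: "\<And>x y. near x y \<Longrightarrow> near y x"
    and pair: "\<And>M M' P. M \<in> V \<Longrightarrow> M' \<in> V \<Longrightarrow> P \<in> tables s w \<Longrightarrow>
       (\<And>i. i < s \<Longrightarrow> i \<notin> F M \<Longrightarrow> M ! i = P ! i) \<Longrightarrow>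
       (\<And>i. i < s \<Longrightarrow> i \<notin> F M' \<Longrightarrow> M' ! i = P ! i) \<Longrightarrow> near (X M) (X M')"
    and bound: "\<And>M\<^sub>0. M\<^sub>0 \<in> V \<Longrightarrow>
       card {M \<in> V. \<exists>x y. near (X M) x \<and> near x y \<and> near y (X M\<^sub>0)} \<le> K"
  shows "card V ^ 2 \<le> 4 * 2 ^ (s * w) * K"
proof -
  define S where "S = card (tables s w)"
  have S: "S = 2 ^ (s * w)" by (simp add: S_def card_tables)
  have finV: "finite V" using V finite_tables finite_subset by blast
  have len: "length T = s" if "T \<in> tables s w" for T
    using that by (simp add: tables_def)
  \<comment> \<open>The first component is the background: \<open>M\<close> with its transcript
    cells taken from \<open>N\<close>. The second is \<open>N\<close> with the transcript of
    \<open>M\<close> imposed; by \<open>closed\<close> it has the same \<open>F\<close> and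
    \<open>X\<close> as \<open>M\<close>.\<close>
  define \<Phi> where "\<Phi> = (\<lambda>(M, N). (overwrite (F M) M N, overwrite (F M) N M))"
  have \<Phi>_snd: "F (snd (\<Phi> (M, N))) = F M" "X (snd (\<Phi> (M, N))) = X M"
    and \<Phi>_tab: "\<Phi> (M, N) \<in> tables s w \<times> tables s w"
    and \<Phi>_nth: "\<And>i. i < s \<Longrightarrow> i \<notin> F M \<Longrightarrow> M ! i = fst (\<Phi> (M, N)) ! i"
    "\<And>i. i < s \<Longrightarrow> i \<in> F M \<Longrightarrow> N ! i = fst (\<Phi> (M, N)) ! i"
    "\<And>i. i < s \<Longrightarrow> i \<in> F M \<Longrightarrow> M ! i = snd (\<Phi> (M, N)) ! i"
    "\<And>i. i < s \<Longrightarrow> i \<notin> F M \<Longrightarrow> N ! i = snd (\<Phi> (M, N)) ! i"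
    if "M \<in> V" "N \<in> tables s w" for M N
  proof -
    have MN: "length M = s" "length N = s" "M \<in> tables s w" using that V len by auto
    show "\<Phi> (M, N) \<in> tables s w \<times> tables s w"
      using that MN by (simp add: \<Phi>_def overwrite_in_tables)
    have "F (overwrite (F M) N M) = F M \<and> X (overwrite (F M) N M) = X M"
      using that MN F[OF that(1)] by (intro closed overwrite_in_tables) (auto simp: subset_iff)
    then show "F (snd (\<Phi> (M, N))) = F M" "X (snd (\<Phi> (M, N))) = X M"
      by (simp_all add: \<Phi>_def)
    show "\<And>i. i < s \<Longrightarrow> i \<notin> F M \<Longrightarrow> M ! i = fst (\<Phi> (M, N)) ! i"
      "\<And>i. i < s \<Longrightarrow> i \<in> F M \<Longrightarrow> N ! i = fst (\<Phi> (M, N)) ! i"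
      "\<And>i. i < s \<Longrightarrow> i \<in> F M \<Longrightarrow> M ! i = snd (\<Phi> (M, N)) ! i"
      "\<And>i. i < s \<Longrightarrow> i \<notin> F M \<Longrightarrow> N ! i = snd (\<Phi> (M, N)) ! i"
      using MN by (simp_all add: \<Phi>_def)
  qed
  have inj: "inj_on \<Phi> (V \<times> tables s w)"
  proof (rule inj_onI, clarify)
    fix M N M' N'
    assume MN: "M \<in> V" "N \<in> tables s w" "M' \<in> V" "N' \<in> tables s w"
      and eq: "\<Phi> (M, N) = \<Phi> (M', N')"
    \<comment> \<open>The second component reveals which cells were exchanged, so the exchange can
      be undone.\<close>
    have FF: "F M = F M'"
      using \<Phi>_snd(1)[OF MN(1,2)] \<Phi>_snd(1)[OF MN(3,4)] eq by simp
    have "M ! i = M' ! i \<and> N ! i = N' ! i" if "i < s" for i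
      using \<Phi>_nth[OF MN(1,2) that] \<Phi>_nth[OF MN(3,4) that] eq FF by (cases "i \<in> F M") auto
    moreover have "length M = s" "length M' = s" "length N = s" "length N' = s"
      using MN V len by auto
    ultimately show "M = M' \<and> N = N'"
      by (simp add: list_eq_iff_nth_eq)
  qed
  define Rel where "Rel = \<Phi> ` (V \<times> tables s w)"
  have card_Rel: "card Rel = card V * S"
    unfolding Rel_def S_def card_image[OF inj] by (rule card_cartesian_product)
  have Rel_sub: "Rel \<subseteq> tables s w \<times> tables s w"
    unfolding Rel_def using \<Phi>_tab by blast
  have finRel: "finite Rel" using Rel_sub finite_tables finite_subset by blast
  define slice where "slice = (\<lambda>P. {Q. (P, Q) \<in> Rel})"
  have finslice: "finite (slice P)" for P
    using finite_tables by (rule finite_subset[rotated]) (use Rel_sub in \<open>auto simp: slice_def\<close>)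
  have slice_tab: "Q \<in> tables s w" if "Q \<in> slice P" for P Q
    using that Rel_sub by (auto simp: slice_def)
  have slice_near: "near (X Q) (X Q')" if "Q \<in> slice P" "Q' \<in> slice P" for P Q Q'
  proof -
    from that obtain M N M' N' where MN: "M \<in> V" "N \<in> tables s w" "M' \<in> V" "N' \<in> tables s w"
      and eq: "(P, Q) = \<Phi> (M, N)" "(P, Q') = \<Phi> (M', N')"
      by (auto simp: slice_def Rel_def)
    have P: "fst (\<Phi> (M, N)) = P" "fst (\<Phi> (M', N')) = P" "P \<in> tables s w"
      using \<Phi>_tab[OF MN(1,2)] unfolding eq[symmetric] by simp_all
    have "near (X M) (X M')"
      using \<Phi>_nth(1)[OF MN(1,2)] \<Phi>_nth(1)[OF MN(3,4)] P by (intro pair[OF MN(1,3) P(3)]) auto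
    then show ?thesis
      using \<Phi>_snd(2)[OF MN(1,2)] \<Phi>_snd(2)[OF MN(3,4)] eq[symmetric] by simp
  qed
  define ball where "ball = (\<lambda>M. {Q \<in> tables s w. near (X Q) (X M)})"
  \<comment> \<open>A background has \<open>card V\<close> partners on average, so the backgrounds
    with at most half of that account for at most half of \<open>Rel\<close>. The same threshold is
    used for the balls.\<close>
  define heavy where "heavy = {M \<in> V. card V < 2 * card (ball M)}"
  have finball: "finite (ball M)" for M
    using finite_tables by (simp add: ball_def)
  obtain Z where Z: "Z \<subseteq> heavy"
    and disj: "\<And>x y. x \<in> Z \<Longrightarrow> y \<in> Z \<Longrightarrow> x \<noteq> y \<Longrightarrow> ball x \<inter> ball y = {}"
    and cover: "\<And>x. x \<in> heavy \<Longrightarrow> ball x \<noteq> {} \<Longrightarrow> \<exists>z\<in>Z. ball x \<inter> ball z \<noteq> {}"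
  proof -
    have "finite heavy" using finV by (simp add: heavy_def)
    from maximal_disjoint_subfamily[OF this, of ball] that show thesis by metis
  qed
  have ZV: "Z \<subseteq> V" using Z by (auto simp: heavy_def)
  then have finZ: "finite Z" using finV finite_subset by blast
  \<comment> \<open>Disjoint balls, each with more than \<open>card V / 2\<close> of the
    \<open>S\<close> tables, must be few.\<close>
  have "card Z * card V \<le> (\<Sum>z\<in>Z. 2 * card (ball z))"
  proof -
    have "card V \<le> 2 * card (ball z)" if "z \<in> Z" for z
      using that Z by (auto simp: heavy_def)
    from sum_bounded_below[of Z "card V" "\<lambda>z. 2 * card (ball z)", OF this] show ?thesis by simp
  qed
  also have "\<dots> = 2 * card (\<Union>z\<in>Z. ball z)"
    using card_UN_disjoint[of Z ball] finZ finball disj by (simp add: sum_distrib_left)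
  also have "\<dots> \<le> 2 * S"
  proof -
    have "(\<Union>z\<in>Z. ball z) \<subseteq> tables s w" by (auto simp: ball_def)
    then show ?thesis using card_mono[OF finite_tables] by (simp add: S_def)
  qed
  finally have ZS: "card Z * card V \<le> 2 * S" .
  define L where "L = {P \<in> tables s w. 2 * card (slice P) \<le> card V}"
  define near3 where
    "near3 = (\<lambda>z. {M \<in> V. \<exists>x y. near (X M) x \<and> near x y \<and> near y (X z)})"
  have covered: "Rel \<subseteq> Sigma L slice \<union> (\<Union>z\<in>Z. \<Phi> ` (near3 z \<times> tables s w))"
  proof
    fix p assume p: "p \<in> Rel"
    then obtain M N where MN: "M \<in> V" "N \<in> tables s w" and pe: "p = \<Phi> (M, N)"
      by (auto simp: Rel_def)
    obtain P Q where PQ: "p = (P, Q)" by (cases p)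
    have Q: "Q \<in> slice P" using p PQ by (simp add: slice_def)
    show "p \<in> Sigma L slice \<union> (\<Union>z\<in>Z. \<Phi> ` (near3 z \<times> tables s w))"
    proof (cases "P \<in> L")
      case True
      with Q show ?thesis unfolding PQ by blast
    next
      case False
      have eq: "\<Phi> (M, N) = (P, Q)" using pe PQ by simp
      have XQ: "X Q = X M" using \<Phi>_snd(2)[OF MN] unfolding eq by simp
      have "P \<in> tables s w" using \<Phi>_tab[OF MN] unfolding eq by simp
      with False have "card V < 2 * card (slice P)" by (simp add: L_def)
      moreover have "slice P \<subseteq> ball M"
        using slice_near[OF _ Q] slice_tab unfolding XQ ball_def by blast
      then have "card (slice P) \<le> card (ball M)" by (intro card_mono finball)
      ultimately have "M \<in> heavy" using MN by (simp add: heavy_def)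
      moreover have "M \<in> ball M" using MN V refl by (auto simp: ball_def)
      ultimately obtain z where z: "z \<in> Z" "ball M \<inter> ball z \<noteq> {}" using cover by blast
      then obtain Q' where "near (X Q') (X M)" "near (X Q') (X z)" by (auto simp: ball_def)
      then have "M \<in> near3 z" using MN refl sym by (auto simp: near3_def)
      then show ?thesis using z MN pe by blast
    qed
  qed
  have finL: "finite L" using finite_tables by (simp add: L_def)
  have "2 * card (Sigma L slice) = (\<Sum>P\<in>L. 2 * card (slice P))"
    using finL finslice by (simp add: card_SigmaI sum_distrib_left)
  also have "\<dots> \<le> card L * card V"
  proof -
    have "2 * card (slice P) \<le> card V" if "P \<in> L" for P
      using that by (simp add: L_def)
    from sum_bounded_above[of L "\<lambda>P. 2 * card (slice P)" "card V", OF this] show ?thesis by simp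
  qed
  also have "\<dots> \<le> S * card V"
  proof -
    have "L \<subseteq> tables s w" by (auto simp: L_def)
    then show ?thesis using card_mono[OF finite_tables] by (simp add: S_def)
  qed
  finally have light: "2 * card (Sigma L slice) \<le> S * card V" .
  have near3_sub: "near3 z \<subseteq> V" for z by (auto simp: near3_def)
  have img: "card (\<Phi> ` (near3 z \<times> tables s w)) \<le> K * S" if "z \<in> Z" for z
  proof -
    have "card (\<Phi> ` (near3 z \<times> tables s w)) \<le> card (near3 z \<times> tables s w)"
      using finite_subset[OF near3_sub finV] finite_tables
      by (intro card_image_le finite_cartesian_product)
    also have "\<dots> \<le> K * S"
      using bound[of z] that ZV by (simp add: card_cartesian_product S_def near3_def subset_iff)
    finally show ?thesis .
  qed
  have fins: "finite (\<Phi> ` (near3 z \<times> tables s w))" for z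
    using finite_subset[OF near3_sub finV] finite_tables
    by (intro finite_imageI finite_cartesian_product)
  have "card Rel \<le> card (Sigma L slice) + card (\<Union>z\<in>Z. \<Phi> ` (near3 z \<times> tables s w))"
    by (rule order_trans[OF card_mono[OF _ covered] card_Un_le]) (use finL finslice finZ fins in auto)
  also have "card (\<Union>z\<in>Z. \<Phi> ` (near3 z \<times> tables s w)) \<le> card Z * (K * S)"
    by (rule order_trans[OF card_UN_le[OF finZ] sum_bounded_above[OF img, of Z, simplified]])
  finally have "card Rel \<le> card (Sigma L slice) + card Z * (K * S)"
    by simp
  moreover have "card Rel = S * card V"
    unfolding card_Rel by (rule mult.commute)
  \<comment> \<open>The packed balls account for the other half of \<open>Rel\<close>. One more
    factor \<open>card V\<close> then lets \<open>ZS\<close> eliminate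
    \<open>card Z\<close>.\<close>
  ultimately have "S * card V \<le> 2 * (card Z * (K * S))"
    using light by linarith
  also have "\<dots> = S * (2 * (card Z * K))"
    by (simp only: ac_simps)
  finally have "card V \<le> 2 * (card Z * K)"
    using S by simp
  then have "card V * card V \<le> 2 * (card Z * K) * card V"
    by (rule mult_right_mono) simp
  also have "\<dots> = 2 * K * (card Z * card V)"
    by (simp only: ac_simps)
  also have "\<dots> \<le> 2 * K * (2 * S)"
    by (rule mult_left_mono[OF ZS]) simp
  also have "\<dots> = 4 * S * K"
    by simp
  finally show ?thesis by (simp only: S power2_eq_square)
qed


section \<open>Anticoncentration of the ranks\<close>

text \<open>The bound 4^m / sqrt (2m + 1), squared to stay within the naturals. The induction step
  rests on the ratio 2 (2m + 1) / (m + 1) of consecutive central coefficients and on (2m + 1) (2m +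
  3) \<le> 4 (m + 1)^2.\<close>

lemma central_binomial_square: "((2 * m) choose m)\<^sup>2 * (2 * m + 1) \<le> 16 ^ m"
proof (induction m)
  case 0
  then show ?case by simp
next
  case (Suc m)
  define a b where "a = ((2 * m) choose m)" and "b = ((2 * Suc m) choose Suc m)"
  have "b = ((2 * m + 1) choose m) + ((2 * m + 1) choose Suc m)"
    by (simp add: b_def)
  also have "((2 * m + 1) choose m) = ((2 * m + 1) choose Suc m)"
    by (subst binomial_symmetric) simp_all
  finally have "b * Suc m = 2 * (((2 * m + 1) choose Suc m) * Suc m)"
    by (simp add: algebra_simps)
  also have "((2 * m + 1) choose Suc m) * Suc m = (2 * m + 1) * a"
    using Suc_times_binomial_eq[of "2 * m" m] by (simp add: a_def)
  finally have b: "b * Suc m = 2 * (2 * m + 1) * a"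
    by (simp only: mult.assoc)
  have "(b\<^sup>2 * (2 * Suc m + 1)) * (Suc m)\<^sup>2 = (b * Suc m)\<^sup>2 * (2 * m + 3)"
    by (simp add: power2_eq_square algebra_simps)
  also have "\<dots> = 4 * (2 * m + 1) * (2 * m + 3) * (a\<^sup>2 * (2 * m + 1))"
    unfolding b by (simp add: power2_eq_square algebra_simps)
  also have "\<dots> \<le> 4 * (2 * m + 1) * (2 * m + 3) * 16 ^ m"
    using Suc by (intro mult_left_mono) (simp_all add: a_def)
  also have "\<dots> \<le> (16 * (Suc m)\<^sup>2) * 16 ^ m"
    by (intro mult_right_mono) (simp_all add: power2_eq_square algebra_simps)
  also have "\<dots> = 16 ^ Suc m * (Suc m)\<^sup>2"
    by simp
  finally have "b\<^sup>2 * (2 * Suc m + 1) \<le> 16 ^ Suc m"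
    by (rule mult_right_le_imp_le) simp
  then show ?case by (simp only: b_def)
qed

lemma binomial_square_le: "(m choose i)\<^sup>2 * m \<le> 4 ^ m"
proof -
  have "(m choose (m div 2))\<^sup>2 * m \<le> 4 ^ m"
  proof (cases "even m")
    case True
    then obtain q where m: "m = 2 * q" by (elim evenE)
    have "((2 * q) choose q)\<^sup>2 * (2 * q) \<le> ((2 * q) choose q)\<^sup>2 * (2 * q + 1)"
      by (intro mult_left_mono) auto
    also have "\<dots> \<le> 16 ^ q" by (rule central_binomial_square)
    finally show ?thesis by (simp add: m power_mult)
  next
    case False
    then obtain q where m: "m = 2 * q + 1" by (elim oddE)
    have eq: "((2 * Suc q) choose Suc q) = 2 * ((2 * q + 1) choose q)"
    proof -
      have "((2 * q + 1) choose Suc q) = ((2 * q + 1) choose q)"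
        by (subst binomial_symmetric) simp_all
      then show ?thesis by simp
    qed
    have "4 * (((2 * q + 1) choose q)\<^sup>2 * (2 * q + 1))
        \<le> ((2 * Suc q) choose Suc q)\<^sup>2 * (2 * Suc q + 1)"
      unfolding eq by (simp add: power_mult_distrib)
    also have "\<dots> \<le> 16 ^ Suc q" by (rule central_binomial_square)
    finally show ?thesis by (simp add: m power_mult)
  qed
  moreover have "(m choose i)\<^sup>2 * m \<le> (m choose (m div 2))\<^sup>2 * m"
    by (intro mult_right_mono power_mono binomial_maximum) auto
  ultimately show ?thesis by (rule le_trans[rotated])
qed

section \<open>Random exchanges within blocks\<close>

lemma sum_Pow_Un_disjoint:
  assumes "finite D" "finite E" "D \<inter> E = {}"
  shows "(\<Sum>Y\<in>Pow (D \<union> E). f (Y \<inter> D) * g (Y \<inter> E) :: nat) = (\<Sum>Z\<in>Pow D. f Z) * (\<Sum>Z\<in>Pow E. g Z)"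
proof -
  have "(\<Sum>Y\<in>Pow (D \<union> E). f (Y \<inter> D) * g (Y \<inter> E)) = (\<Sum>(Z, Z')\<in>Pow D \<times> Pow E. f Z * g Z')"
    using assms(3)
    by (intro sum.reindex_bij_witness[where i = "\<lambda>(Z, Z'). Z \<union> Z'" and j = "\<lambda>Y. (Y \<inter> D, Y \<inter> E)"]) auto
  then show ?thesis
    by (simp add: sum_product sum.cartesian_product)
qed

text \<open>The traces of a uniformly random \<open>Y\<close> on disjoint sets are independent, so
  the mean of the product is the product of the means, each at most \<open>c\<close>.\<close>

lemma sum_Pow_prod_le:
  fixes f :: "'j \<Rightarrow> 'a set \<Rightarrow> nat"
  assumes "finite J" "finite A"
    and "\<And>j. j \<in> J \<Longrightarrow> D j \<subseteq> A"
    and "\<And>i j. i \<in> J \<Longrightarrow> j \<in> J \<Longrightarrow> i \<noteq> j \<Longrightarrow> D i \<inter> D j = {}"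
    and "\<And>j. j \<in> J \<Longrightarrow> (\<Sum>Z\<in>Pow (D j). f j Z) \<le> c * 2 ^ card (D j)"
  shows "(\<Sum>Y\<in>Pow A. \<Prod>j\<in>J. f j (Y \<inter> D j)) \<le> c ^ card J * 2 ^ card A"
  using assms
proof (induction J arbitrary: A rule: finite_induct)
  case empty
  then show ?case by (simp add: card_Pow)
next
  case (insert i J)
  define E where "E = A - D i"
  have fin: "finite (D i)" "finite E" and A: "D i \<union> E = A" and disj: "D i \<inter> E = {}"
    using insert.prems(1) insert.prems(2)[of i] by (auto simp: E_def intro: finite_subset)
  have DE: "D j \<subseteq> E" if "j \<in> J" for j
    using insert.prems(2)[of j] insert.prems(3)[of i j] that insert.hyps by (auto simp: E_def)
  have "(\<Sum>Y\<in>Pow A. \<Prod>j\<in>insert i J. f j (Y \<inter> D j)) =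
      (\<Sum>Y\<in>Pow (D i \<union> E). f i (Y \<inter> D i) * (\<Prod>j\<in>J. f j ((Y \<inter> E) \<inter> D j)))"
    unfolding A
  proof (intro sum.cong refl)
    fix Y
    have "(Y \<inter> E) \<inter> D j = Y \<inter> D j" if "j \<in> J" for j using DE[OF that] by blast
    then show "(\<Prod>j\<in>insert i J. f j (Y \<inter> D j)) =
        f i (Y \<inter> D i) * (\<Prod>j\<in>J. f j ((Y \<inter> E) \<inter> D j))"
      using insert.hyps by simp
  qed
  also have "\<dots> = (\<Sum>Z\<in>Pow (D i). f i Z) * (\<Sum>Z\<in>Pow E. \<Prod>j\<in>J. f j (Z \<inter> D j))"
    by (rule sum_Pow_Un_disjoint[OF fin disj])
  also have "\<dots> \<le> (c * 2 ^ card (D i)) * (c ^ card J * 2 ^ card E)"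
    using insert.prems fin DE by (intro mult_mono insert.IH) auto
  also have "\<dots> = c ^ card (insert i J) * 2 ^ card A"
    using insert.hyps card_Un_disjoint[OF fin disj] A by (simp add: power_add)
  finally show ?case .
qed

text \<open>Symmetric difference with \<open>S\<close> is an involution of \<open>Pow U\<close>, so
  only \<open>card Z\<close> matters. The window contains at most \<open>481 * y\<close> sizes, each
  of probability at most 1 / sqrt (\<open>card U\<close>), and 52056225 is the square of 15 *
  481.\<close>

lemma card_subsets_size_window:
  assumes U: "finite U" "S \<subseteq> U" and y: "0 < y" and m: "0 < card U"
    and big: "52056225 * y\<^sup>2 \<le> card U"
  shows "15 * card {Z \<in> Pow U. \<bar>c + int (card {u \<in> U. (u \<in> S) \<noteq> (u \<in> Z)})\<bar> \<le> 240 * int y}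
    \<le> 2 ^ card U"
proof -
  define m where "m = card U"
  define N where "N = card {Z \<in> Pow U. \<bar>c + int (card {u \<in> U. (u \<in> S) \<noteq> (u \<in> Z)})\<bar> \<le> 240 * int y}"
  define I where "I = {i. \<bar>c + int i\<bar> \<le> 240 * int y}"
  have I: "finite I" "card I \<le> 481 * y"
  proof -
    have sub: "int ` I \<subseteq> {- c - 240 * int y .. - c + 240 * int y}" by (auto simp: I_def)
    then have "finite (int ` I)" by (rule finite_subset) simp
    then show "finite I" by (rule finite_imageD) simp
    have "card I = card (int ` I)" by (simp add: card_image)
    also have "\<dots> \<le> card {- c - 240 * int y .. - c + 240 * int y}"
      by (intro card_mono sub) simp
    also have "\<dots> \<le> 481 * y" using y by simp
    finally show "card I \<le> 481 * y" .
  qed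
  have "N = card {Z \<in> Pow U. \<bar>c + int (card Z)\<bar> \<le> 240 * int y}"
    unfolding N_def
  proof (intro bij_betw_same_card[of "\<lambda>Z. {u \<in> U. (u \<in> S) \<noteq> (u \<in> Z)}"]
      bij_betw_byWitness[where f' = "\<lambda>Z. {u \<in> U. (u \<in> S) \<noteq> (u \<in> Z)}"] ballI)
    have inv: "{u \<in> U. (u \<in> S) \<noteq> (u \<in> {u \<in> U. (u \<in> S) \<noteq> (u \<in> Z)})} = Z" if "Z \<subseteq> U" for Z
      using that by blast
    show "{u \<in> U. (u \<in> S) \<noteq> (u \<in> {u \<in> U. (u \<in> S) \<noteq> (u \<in> Z)})} = Z"
      if "Z \<in> {Z \<in> Pow U. \<bar>c + int (card {u \<in> U. (u \<in> S) \<noteq> (u \<in> Z)})\<bar> \<le> 240 * int y}" for Z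
      using inv that by blast
    show "{u \<in> U. (u \<in> S) \<noteq> (u \<in> {u \<in> U. (u \<in> S) \<noteq> (u \<in> Z)})} = Z"
      if "Z \<in> {Z \<in> Pow U. \<bar>c + int (card Z)\<bar> \<le> 240 * int y}" for Z
      using inv that by blast
    show "(\<lambda>Z. {u \<in> U. (u \<in> S) \<noteq> (u \<in> Z)}) `
        {Z \<in> Pow U. \<bar>c + int (card {u \<in> U. (u \<in> S) \<noteq> (u \<in> Z)})\<bar> \<le> 240 * int y}
        \<subseteq> {Z \<in> Pow U. \<bar>c + int (card Z)\<bar> \<le> 240 * int y}"
      by (rule image_subsetI) simp
    show "(\<lambda>Z. {u \<in> U. (u \<in> S) \<noteq> (u \<in> Z)}) ` {Z \<in> Pow U. \<bar>c + int (card Z)\<bar> \<le> 240 * int y}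
        \<subseteq> {Z \<in> Pow U. \<bar>c + int (card {u \<in> U. (u \<in> S) \<noteq> (u \<in> Z)})\<bar> \<le> 240 * int y}"
    proof (rule image_subsetI)
      fix Z assume "Z \<in> {Z \<in> Pow U. \<bar>c + int (card Z)\<bar> \<le> 240 * int y}"
      with inv[of Z] show "{u \<in> U. (u \<in> S) \<noteq> (u \<in> Z)} \<in>
          {Z \<in> Pow U. \<bar>c + int (card {u \<in> U. (u \<in> S) \<noteq> (u \<in> Z)})\<bar> \<le> 240 * int y}"
        by (simp only: mem_Collect_eq Pow_iff) blast
    qed
  qed
  also have "{Z \<in> Pow U. \<bar>c + int (card Z)\<bar> \<le> 240 * int y} = (\<Union>i\<in>I. {Z. Z \<subseteq> U \<and> card Z = i})"
    by (auto simp: I_def)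
  also have "card \<dots> \<le> (\<Sum>i\<in>I. card {Z. Z \<subseteq> U \<and> card Z = i})"
    by (rule card_UN_le[OF I(1)])
  also have "\<dots> \<le> card I * (m choose (m div 2))"
    using sum_bounded_above[of I "\<lambda>i. card {Z. Z \<subseteq> U \<and> card Z = i}" "m choose (m div 2)"]
    by (simp add: n_subsets[OF U(1)] m_def binomial_maximum)
  also have "\<dots> \<le> 481 * y * (m choose (m div 2))"
    by (rule mult_right_mono[OF I(2)]) simp
  finally have N: "N \<le> 481 * y * (m choose (m div 2))" .
  have "(15 * N)\<^sup>2 * m \<le> (15 * (481 * y * (m choose (m div 2))))\<^sup>2 * m"
    by (intro mult_right_mono power_mono mult_left_mono N) auto
  also have "\<dots> = 52056225 * y\<^sup>2 * ((m choose (m div 2))\<^sup>2 * m)"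
    by (simp add: power_mult_distrib)
  also have "\<dots> \<le> 52056225 * y\<^sup>2 * 4 ^ m"
    by (intro mult_mono binomial_square_le) auto
  also have "\<dots> \<le> m * 4 ^ m"
    using big by (intro mult_right_mono) (auto simp: m_def)
  also have "\<dots> = (2 ^ m)\<^sup>2 * m"
    by (simp add: power2_eq_square flip: power_mult_distrib)
  finally have "(15 * N)\<^sup>2 \<le> (2 ^ m)\<^sup>2"
    using m by (simp add: m_def)
  then have "15 * N \<le> 2 ^ m"
    by (rule power2_le_imp_le) simp
  then show ?thesis by (simp add: N_def m_def)
qed

lemma sum_if_eq_card: "finite A \<Longrightarrow> (\<Sum>a\<in>A. if P a then 1 else 0 :: nat) = card {a \<in> A. P a}"
  by (simp only: card_eq_sum sum.inter_filter)

text \<open>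
  The positions above \<open>n div 2\<close> are cut into \<open>k\<close> blocks of length \<open>2 * B\<close>. Exchanging the two halves
  of every block is an involution on right endpoints, which may be applied independently to all
  vertices \<open>u \<le> n div 2\<close>; it moves the rank of the middle of a block by a binomial amount. Since
  \<open>B = 2 ^ 28 * y\<^sup>2\<close>, this amount typically exceeds by far the fluctuation, of order \<open>y\<close>, of the rank
  within the \<open>y\<^sup>2\<close> positions that follow the middle.
\<close>

locale grid =
  fixes n k y :: nat
  assumes y: "0 < y" and k: "0 < k" and size: "2 ^ 31 * k * y\<^sup>2 \<le> n"
begin

definition h where "h = n div 2"
definition B where "B = 2 ^ 28 * y\<^sup>2"
definition start where "start j = h + 1 + 2 * B * j"
definition mid where "mid j = start j + B"
definition blk where "blk e j = {u \<in> {1..h}. start j \<le> e u \<and> e u < start j + 2 * B}"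

definition flip where
  "flip x = (if h < x \<and> x \<le> h + 2 * B * k
             then if even ((x - h - 1) div B) then x + B else x - B else x)"

definition act where "act Y e = (\<lambda>u. if u \<in> Y then flip (e u) else e u)"

lemma B_pos: "0 < B"
  using y by (simp add: B_def)

text \<open>The factor \<open>2 ^ 31\<close> in \<open>size\<close> is \<open>8 * 2 ^ 28\<close>.
  The blocks fill at most a quarter of the positions and end by 3n/4, so vertices up to there retain
  at least n/4 possible endpoints.\<close>

lemma grid_end: "4 * (2 * B * k) \<le> n" "h + 2 * B * k \<le> n"
proof -
  show "4 * (2 * B * k) \<le> n"
    using size by (simp add: B_def algebra_simps)
  then show "h + 2 * B * k \<le> n"
    by (simp add: h_def)
qed

lemma block_le_end:
  assumes "j < k" shows "start j + 2 * B \<le> h + 1 + 2 * B * k"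
proof -
  have "2 * B * Suc j \<le> 2 * B * k" using assms by (intro mult_left_mono) auto
  then show ?thesis by (simp add: start_def)
qed

lemma block_le_n: "j < k \<Longrightarrow> start j + 2 * B \<le> Suc n"
  using block_le_end[of j] grid_end(2) by simp

lemma flip_block:
  assumes "j < k" "i < 2 * B"
  shows "flip (start j + i) = start j + (if i < B then i + B else i - B)"
proof -
  have "start j + i \<le> h + 2 * B * k" "h < start j + i"
    using block_le_end[OF assms(1)] assms(2) by (auto simp: start_def)
  moreover have "(start j + i - h - 1) div B = 2 * j + i div B"
  proof -
    have "start j + i - h - 1 = B * (2 * j) + i" by (simp add: start_def)
    then show ?thesis using B_pos by simp
  qed
  moreover have "i div B = (if i < B then 0 else 1)"
    using assms(2) B_pos by (auto simp: div_if)
  ultimately show ?thesis by (cases "i < B") (simp_all add: flip_def start_def)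
qed

lemma block_cases:
  obtains "flip x = x" "\<And>j. j < k \<Longrightarrow> x < start j \<or> start j + 2 * B \<le> x"
  | j i where "j < k" "i < 2 * B" "x = start j + i"
proof (cases "h < x \<and> x \<le> h + 2 * B * k")
  case True
  define j where "j = (x - h - 1) div (2 * B)"
  define i where "i = (x - h - 1) mod (2 * B)"
  have x: "x = start j + i"
  proof -
    have "2 * B * j + i = x - h - 1" unfolding j_def i_def by (rule mult_div_mod_eq)
    then show ?thesis using True unfolding start_def by linarith
  qed
  have i: "i < 2 * B" using B_pos by (simp add: i_def)
  have "x - h - 1 < k * (2 * B)" using True by (simp only: mult.commute mult.left_commute) linarith
  then have "j < k" unfolding j_def by (rule less_mult_imp_div_less)
  from that(2)[OF this i x] show ?thesis .
next
  case False
  have "x < start j \<or> start j + 2 * B \<le> x" if "j < k" for j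
    using False block_le_end[OF that] by (auto simp: start_def)
  moreover have "flip x = x" unfolding flip_def using False by (rule if_not_P)
  ultimately show ?thesis using that(1) by blast
qed

lemma start_less:
  assumes "i < j" shows "start i + 2 * B \<le> start j"
proof -
  have "2 * B * Suc i \<le> 2 * B * j" using assms by (intro mult_left_mono) auto
  then show ?thesis by (simp add: start_def)
qed

lemma flip_flip: "flip (flip x) = x"
proof (cases rule: block_cases[of x])
  case (2 j i)
  show ?thesis
  proof (cases "i < B")
    case True
    then show ?thesis using 2 flip_block[of j i] flip_block[of j "i + B"] by simp
  next
    case False
    then show ?thesis using 2 flip_block[of j i] flip_block[of j "i - B"] by simp
  qed
qed simp

lemma flip_in_block:
  assumes "j < k"
  shows "start j \<le> flip x \<and> flip x < start j + 2 * B \<longleftrightarrow> start j \<le> x \<and> x < start j + 2 * B"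
proof (cases rule: block_cases[of x])
  case (2 j' i)
  have fx: "start j' \<le> flip x" "flip x < start j' + 2 * B"
    using 2 flip_block[of j' i] by auto
  consider "j = j'" | "j < j'" | "j' < j" by linarith
  then show ?thesis
  proof cases
    case 1
    then show ?thesis using 2 fx by auto
  next
    case 2
    then show ?thesis using start_less[of j j'] fx \<open>x = start j' + i\<close> by auto
  next
    case 3
    then show ?thesis using start_less[of j' j] fx \<open>x = start j' + i\<close> \<open>i < 2 * B\<close> by auto
  qed
qed simp

text \<open>Any other block lies entirely on one side of \<open>mid j\<close>, so exchanging its
  halves is invisible from there.\<close>

lemma flip_less_mid:
  assumes "j < k"
  shows "flip x < mid j \<longleftrightarrow> (if start j \<le> x \<and> x < start j + 2 * B then \<not> x < mid j else x < mid j)"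
proof (cases rule: block_cases[of x])
  case 1
  then show ?thesis using 1(2)[OF assms] by auto
next
  case (2 j' i)
  have fx: "start j' \<le> flip x" "flip x < start j' + 2 * B"
    using 2 flip_block[of j' i] by auto
  consider "j = j'" | "j < j'" | "j' < j" by linarith
  then show ?thesis
  proof cases
    case 1
    then show ?thesis using 2 flip_block[of j' i] by (auto simp: mid_def)
  next
    case 2
    then show ?thesis using start_less[of j j'] fx \<open>x = start j' + i\<close> by (auto simp: mid_def)
  next
    case 3
    then show ?thesis using start_less[of j' j] fx \<open>x = start j' + i\<close> \<open>i < 2 * B\<close>
      by (auto simp: mid_def)
  qed
qed

text \<open>All blocks lie above \<open>h\<close>, so the restriction \<open>u \<le> h\<close>
  prevents a flipped endpoint from falling below its vertex.\<close>

lemma flip_bounds: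
  assumes "u \<le> h" "u \<le> x" "x \<le> n"
  shows "u \<le> flip x" "flip x \<le> n"
proof -
  have "u \<le> flip x \<and> flip x \<le> n"
  proof (cases rule: block_cases[of x])
    case 1
    then show ?thesis using assms by simp
  next
    case (2 j i)
    then show ?thesis using flip_block[of j i] block_le_n[of j] assms(1) by (auto simp: start_def)
  qed
  then show "u \<le> flip x" "flip x \<le> n" by auto
qed

lemma act_act: "act Y (act Y e) = e"
  by (auto simp: act_def flip_flip)

lemma h_le_n: "h \<le> n" by (simp add: h_def)

lemma act_in_universal_reps:
  assumes "Y \<subseteq> {1..h}" "e \<in> universal_reps n"
  shows "act Y e \<in> universal_reps n"
  unfolding universal_reps_def
proof (rule PiE_I)
  fix u assume u: "u \<in> {1..n}"
  show "act Y e u \<in> {u..n}"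
    using universal_repsD[OF assms(2) u] flip_bounds[of u "e u"] assms(1) by (auto simp: act_def)
next
  fix u assume u: "u \<notin> {1..n}"
  then have "u \<notin> Y" using assms(1) h_le_n by auto
  moreover have "e u = undefined"
    using assms(2) u unfolding universal_reps_def by (rule PiE_arb)
  ultimately show "act Y e u = undefined" by (simp add: act_def)
qed

lemma sum_act:
  assumes "Y \<subseteq> {1..h}"
  shows "(\<Sum>e\<in>universal_reps n. f (act Y e)) = (\<Sum>e\<in>universal_reps n. f e)"
  by (rule sum.reindex_bij_witness[where i = "act Y" and j = "act Y"])
    (auto simp: act_act act_in_universal_reps[OF assms])

lemma blk_act: "j < k \<Longrightarrow> blk (act Y e) j = blk e j"
  using flip_in_block by (auto simp: blk_def act_def)

lemma finite_blk: "finite (blk e j)"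
  by (simp add: blk_def)

text \<open>The rank depends on \<open>Y\<close> only through its trace on the block, via the size
  of a symmetric difference. For random \<open>Y\<close> the ranks of the middles are therefore
  independent shifted binomials.\<close>

lemma endrank_mid_act:
  assumes "j < k" "Y \<subseteq> {1..h}"
  shows "endrank n (act Y e) (mid j) =
    card {u \<in> {1..n} - blk e j. e u < mid j} +
    card {u \<in> blk e j. (u \<in> {u. e u < mid j}) \<noteq> (u \<in> Y \<inter> blk e j)}"
proof -
  have "act Y e u < mid j \<longleftrightarrow> e u < mid j" if "u \<notin> blk e j" for u
    using that flip_less_mid[OF assms(1), of "e u"] assms(2) by (auto simp: act_def blk_def)
  moreover have "act Y e u < mid j \<longleftrightarrow> (e u < mid j) \<noteq> (u \<in> Y)" if "u \<in> blk e j" for u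
    using that flip_less_mid[OF assms(1), of "e u"] by (auto simp: act_def blk_def)
  ultimately have "{u \<in> {1..n}. act Y e u < mid j} = {u \<in> {1..n} - blk e j. e u < mid j} \<union>
      {u \<in> blk e j. (u \<in> {u. e u < mid j}) \<noteq> (u \<in> Y \<inter> blk e j)}"
    using h_le_n by (auto simp: blk_def)
  then show ?thesis
    unfolding endrank_def by (simp only:) (rule card_Un_disjoint; auto simp: finite_blk)
qed

text \<open>An exponential moment bound. Averaging over the exchanges preserves the uniform measure
  on inputs. The weight 16 for a hit gives each block a mean of at most 1 + 15 / 15 = 2, so
  \<open>g\<close> has mean at most 2^k. With 3k/4 hits \<open>g\<close> is at least 2^(3k), and
  Markov's inequality leaves a fraction of 2^(-2k).\<close>

lemma spread:
  fixes x :: "nat \<Rightarrow> int"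
  shows "card {e \<in> universal_reps n. 3 * k \<le> 4 * card {j \<in> {..<k}. B \<le> 3 * card (blk e j) \<and>
      \<bar>int (endrank n e (mid j)) - x j\<bar> \<le> 240 * int y}} * 2 ^ (2 * k) \<le> fact n"
proof -
  define hit where "hit = (\<lambda>e j. B \<le> 3 * card (blk e j) \<and>
      \<bar>int (endrank n e (mid j)) - x j\<bar> \<le> 240 * int y)"
  define g :: "(nat \<Rightarrow> nat) \<Rightarrow> nat" where "g = (\<lambda>e. \<Prod>j<k. if hit e j then 16 else 1)"
  define E where "E = {e \<in> universal_reps n. 3 * k \<le> 4 * card {j \<in> {..<k}. hit e j}}"
  have each: "(\<Sum>Y\<in>Pow {1..h}. g (act Y e)) \<le> 2 ^ k * 2 ^ h" for e
  proof -
    define base where "base = (\<lambda>j. int (card {u \<in> {1..n} - blk e j. e u < mid j}) - x j)"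
    define S where "S = (\<lambda>j. {u \<in> blk e j. e u < mid j})"
    define near where "near = (\<lambda>j Z. \<bar>base j + int (card {u \<in> blk e j. (u \<in> S j) \<noteq> (u \<in> Z)})\<bar>
        \<le> 240 * int y)"
    define f :: "nat \<Rightarrow> nat set \<Rightarrow> nat" where
      "f = (\<lambda>j Z. if B \<le> 3 * card (blk e j) \<and> near j Z then 16 else 1)"
    have g: "g (act Y e) = (\<Prod>j<k. f j (Y \<inter> blk e j))" if "Y \<in> Pow {1..h}" for Y
      unfolding g_def
    proof (intro prod.cong refl)
      fix j assume j: "j \<in> {..<k}"
      have "{u \<in> blk e j. (u \<in> {u. e u < mid j}) \<noteq> (u \<in> Y \<inter> blk e j)} =
          {u \<in> blk e j. (u \<in> S j) \<noteq> (u \<in> Y \<inter> blk e j)}"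
        by (auto simp: S_def)
      then have "int (endrank n (act Y e) (mid j)) - x j =
          base j + int (card {u \<in> blk e j. (u \<in> S j) \<noteq> (u \<in> Y \<inter> blk e j)})"
        using endrank_mid_act[of j Y e] j that by (simp add: base_def)
      then show "(if hit (act Y e) j then 16 else 1) = f j (Y \<inter> blk e j)"
        using j by (simp add: hit_def f_def near_def blk_act)
    qed
    have sumf: "(\<Sum>Z\<in>Pow (blk e j). f j Z) \<le> 2 * 2 ^ card (blk e j)" for j
    proof -
      have "(\<Sum>Z\<in>Pow (blk e j). f j Z) \<le>
          (\<Sum>Z\<in>Pow (blk e j). 1 + 15 * (if B \<le> 3 * card (blk e j) \<and> near j Z then 1 else 0))"
        by (intro sum_mono) (simp add: f_def)
      also have "\<dots> = 2 ^ card (blk e j) +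
          15 * card {Z \<in> Pow (blk e j). B \<le> 3 * card (blk e j) \<and> near j Z}"
      proof -
        have fin: "finite (Pow (blk e j))" using finite_blk by simp
        show ?thesis
          unfolding sum.distrib sum_distrib_left[symmetric] sum_if_eq_card[OF fin]
          using finite_blk by (simp only: card_eq_sum[symmetric] card_Pow)
      qed
      also have "15 * card {Z \<in> Pow (blk e j). B \<le> 3 * card (blk e j) \<and> near j Z}
          \<le> 2 ^ card (blk e j)"
      proof (cases "B \<le> 3 * card (blk e j)")
        case True
        then have "0 < card (blk e j)" using B_pos by linarith
        moreover have "52056225 * y\<^sup>2 \<le> card (blk e j)"
        proof -
          \<comment> \<open>This is what the factor \<open>2 ^ 28\<close> in \<open>B\<close> is
            for: a third of \<open>B\<close> meets the size condition of
            \<open>card_subsets_size_window\<close>.\<close>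
          have "3 * (52056225 * y\<^sup>2) \<le> B" by (simp add: B_def)
          also note True
          finally show ?thesis by simp
        qed
        moreover have "S j \<subseteq> blk e j" by (auto simp: S_def)
        ultimately have "15 * card {Z \<in> Pow (blk e j). near j Z} \<le> 2 ^ card (blk e j)"
          unfolding near_def by (intro card_subsets_size_window finite_blk y)
        with True show ?thesis by (simp only: simp_thms)
      qed simp
      finally show ?thesis by simp
    qed
    have disj: "blk e i \<inter> blk e j = {}" if "i \<noteq> j" for i j
      using that start_less[of i j] start_less[of j i] by (auto simp: blk_def neq_iff)
    have "(\<Sum>Y\<in>Pow {1..h}. g (act Y e)) = (\<Sum>Y\<in>Pow {1..h}. \<Prod>j<k. f j (Y \<inter> blk e j))"
      by (intro sum.cong refl g)
    also have "\<dots> \<le> 2 ^ card {..<k} * 2 ^ card {1..h}"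
      by (intro sum_Pow_prod_le sumf disj) (auto simp: blk_def)
    finally show ?thesis by simp
  qed
  have "2 ^ h * (\<Sum>e\<in>universal_reps n. g e) = (\<Sum>Y\<in>Pow {1..h}. \<Sum>e\<in>universal_reps n. g (act Y e))"
    by (simp add: sum_act card_Pow)
  also have "\<dots> = (\<Sum>e\<in>universal_reps n. \<Sum>Y\<in>Pow {1..h}. g (act Y e))"
    by (rule sum.swap)
  also have "\<dots> \<le> card (universal_reps n) * (2 ^ k * 2 ^ h)"
    using sum_bounded_above[of "universal_reps n" "\<lambda>e. \<Sum>Y\<in>Pow {1..h}. g (act Y e)"] each by simp
  finally have "2 ^ h * (\<Sum>e\<in>universal_reps n. g e) \<le> 2 ^ h * (fact n * 2 ^ k)"
    by (simp add: card_universal_reps ac_simps)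
  then have total: "(\<Sum>e\<in>universal_reps n. g e) \<le> fact n * 2 ^ k"
    by simp
  have "2 ^ (3 * k) \<le> g e" if "e \<in> E" for e
  proof -
    have "g e = 16 ^ card {j \<in> {..<k}. hit e j}"
      by (simp add: g_def prod.If_cases Int_def)
    also have "\<dots> = 2 ^ (4 * card {j \<in> {..<k}. hit e j})"
      by (simp add: power_mult)
    finally show ?thesis
      using that by (simp add: E_def power_increasing)
  qed
  then have "card E * 2 ^ (3 * k) \<le> (\<Sum>e\<in>E. g e)"
    using sum_bounded_below[of E "2 ^ (3 * k)" g] by simp
  also have "\<dots> \<le> (\<Sum>e\<in>universal_reps n. g e)"
    by (intro sum_mono2 finite_universal_reps) (auto simp: E_def)
  also note total
  finally have "2 ^ k * (card E * 2 ^ (2 * k)) \<le> 2 ^ k * fact n"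
    by (simp add: power_add[symmetric] ac_simps)
  then have "card E * 2 ^ (2 * k) \<le> fact n"
    by simp
  then show ?thesis by (simp add: E_def hit_def)
qed

end


section \<open>Concentration of endpoint counts\<close>

text \<open>In a uniform input \<open>e u\<close> is uniform on \<open>{u..n}\<close>, independently
  of the other endpoints. The identity is this expectation with denominators cleared.\<close>

lemma sum_universal_reps_coord:
  fixes f :: "nat \<Rightarrow> real"
  assumes "u \<in> {1..n}"
  shows "real (Suc n - u) * (\<Sum>e\<in>universal_reps n. f (e u)) = fact n * (\<Sum>x\<in>{u..n}. f x)"
proof -
  let ?f = "\<lambda>i x. if i = u then f x else 1"
  have "(\<Sum>e\<in>universal_reps n. f (e u)) = (\<Sum>e\<in>universal_reps n. \<Prod>i\<in>{1..n}. ?f i (e i))"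
    using assms by (intro sum.cong refl) (simp add: prod.delta)
  also have "\<dots> = (\<Prod>i\<in>{1..n}. \<Sum>x\<in>{i..n}. ?f i x)"
    unfolding universal_reps_def by (rule prod_sum_PiE[symmetric]) auto
  also have "\<dots> = (\<Sum>x\<in>{u..n}. f x) * (\<Prod>i\<in>{1..n} - {u}. real (Suc n - i))"
    using assms by (subst prod.remove[of _ u]) (auto intro!: prod.cong)
  finally have "real (Suc n - u) * (\<Sum>e\<in>universal_reps n. f (e u)) =
      (\<Sum>x\<in>{u..n}. f x) * (real (Suc n - u) * (\<Prod>i\<in>{1..n} - {u}. real (Suc n - i)))"
    by (simp only: ac_simps)
  also have "real (Suc n - u) * (\<Prod>i\<in>{1..n} - {u}. real (Suc n - i)) = (\<Prod>i\<in>{1..n}. real (Suc n - i))"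
    using assms by (subst prod.remove[of _ u]) auto
  also have "\<dots> = (\<Prod>i\<in>{1..n}. real i)"
    by (rule prod.reindex_bij_witness[of _ "\<lambda>i. Suc n - i" "\<lambda>i. Suc n - i"]) auto
  also have "\<dots> = fact n"
    by (simp add: fact_prod)
  finally show ?thesis by (simp only: mult.commute)
qed

text \<open>By independence the factor at \<open>u\<close> splits off and vanishes; this kills the
  cross terms of the variance.\<close>

lemma sum_universal_reps_centred:
  fixes f g :: "nat \<Rightarrow> real"
  assumes "u \<in> {1..n}" "v \<in> {1..n}" "u \<noteq> v" and "(\<Sum>x\<in>{u..n}. f x) = 0"
  shows "(\<Sum>e\<in>universal_reps n. f (e u) * g (e v)) = 0"
proof -
  let ?f = "\<lambda>i x. if i = u then f x else if i = v then g x else 1"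
  have "(\<Sum>e\<in>universal_reps n. f (e u) * g (e v)) =
      (\<Sum>e\<in>universal_reps n. \<Prod>i\<in>{1..n}. ?f i (e i))"
  proof (intro sum.cong refl)
    fix e
    have "(\<Prod>i\<in>{1..n}. ?f i (e i)) = f (e u) * (\<Prod>i\<in>{1..n} - {u}. ?f i (e i))"
      using assms(1) by (subst prod.remove[of _ u]) auto
    also have "(\<Prod>i\<in>{1..n} - {u}. ?f i (e i)) = (\<Prod>i\<in>{1..n} - {u}. if i = v then g (e i) else 1)"
      by (rule prod.cong) auto
    also have "\<dots> = g (e v)"
      using assms(2,3) by (simp add: prod.delta)
    finally show "f (e u) * g (e v) = (\<Prod>i\<in>{1..n}. ?f i (e i))" by simp
  qed
  also have "\<dots> = (\<Prod>i\<in>{1..n}. \<Sum>x\<in>{i..n}. ?f i x)"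
    unfolding universal_reps_def by (rule prod_sum_PiE[symmetric]) auto
  also have "\<dots> = 0"
    using assms(1,4) by (intro prod_zero bexI[of _ u]) auto
  finally show ?thesis .
qed

definition hits :: "nat set \<Rightarrow> nat \<Rightarrow> nat \<Rightarrow> (nat \<Rightarrow> nat) \<Rightarrow> nat" where
  "hits U a b e = card {u \<in> U. a \<le> e u \<and> e u < b}"

text \<open>The expectation of \<open>hits U a b\<close> for a uniform input.\<close>

definition mean_hits :: "nat \<Rightarrow> nat set \<Rightarrow> nat \<Rightarrow> nat \<Rightarrow> real" where
  "mean_hits n U a b = (\<Sum>u\<in>U. real (card ({u..n} \<inter> {a..<b})) / real (Suc n - u))"

text \<open>The variance of a sum of independent indicators is the sum of the p (1 - p), which is at
  most the mean.\<close>

lemma hits_second_moment: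
  assumes U: "U \<subseteq> {1..n}"
  shows "(\<Sum>e\<in>universal_reps n. (real (hits U a b e) - mean_hits n U a b)\<^sup>2)
    \<le> fact n * mean_hits n U a b"
proof -
  have finU: "finite U" using U finite_subset by blast
  define p where "p = (\<lambda>u. real (card ({u..n} \<inter> {a..<b})) / real (Suc n - u))"
  define g :: "nat \<Rightarrow> nat \<Rightarrow> real" where "g = (\<lambda>u x. of_bool (a \<le> x \<and> x < b) - p u)"
  have ind: "(\<Sum>x\<in>{u..n}. of_bool (a \<le> x \<and> x < b) :: real) = p u * real (Suc n - u)"
    if "u \<in> U" for u
  proof -
    have "{u..n} \<inter> {x. a \<le> x \<and> x < b} = {u..n} \<inter> {a..<b}" by auto
    then show ?thesis using that U by (auto simp: p_def of_bool_def sum.If_cases)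
  qed
  have g0: "(\<Sum>x\<in>{u..n}. g u x) = 0" if "u \<in> U" for u
    using ind[OF that] by (simp add: g_def sum_subtractf algebra_simps)
  have g2: "(\<Sum>e\<in>universal_reps n. g u (e u) * g u (e u)) \<le> fact n * p u" if u: "u \<in> U" for u
  proof -
    have pos: "0 < real (Suc n - u)" using u U by auto
    have "(\<Sum>x\<in>{u..n}. g u x * g u x) =
        (\<Sum>x\<in>{u..n}. (1 - 2 * p u) * of_bool (a \<le> x \<and> x < b) + p u * p u)"
      by (intro sum.cong refl) (auto simp: g_def algebra_simps)
    also have "\<dots> = (1 - 2 * p u) * (p u * real (Suc n - u)) + real (Suc n - u) * (p u * p u)"
      unfolding sum.distrib sum_distrib_left[symmetric] ind[OF u] by simp
    also have "\<dots> = real (Suc n - u) * (p u - p u * p u)"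
      by (simp add: algebra_simps)
    also have "\<dots> \<le> real (Suc n - u) * p u"
      using pos by (intro mult_left_mono) (simp_all add: not_less)
    finally have "real (Suc n - u) * (\<Sum>e\<in>universal_reps n. g u (e u) * g u (e u))
        \<le> fact n * (real (Suc n - u) * p u)"
      using sum_universal_reps_coord[of u n "\<lambda>x. g u x * g u x"] u U
      by (auto intro: mult_left_mono)
    then have "real (Suc n - u) * (\<Sum>e\<in>universal_reps n. g u (e u) * g u (e u))
        \<le> real (Suc n - u) * (fact n * p u)"
      by (simp only: ac_simps)
    then show ?thesis
      using pos by (rule mult_left_le_imp_le)
  qed
  have dev: "real (hits U a b e) - mean_hits n U a b = (\<Sum>u\<in>U. g u (e u))" for e
  proof -
    have "U \<inter> {u. a \<le> e u \<and> e u < b} = {u \<in> U. a \<le> e u \<and> e u < b}" by auto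
    then show ?thesis
      using finU by (simp add: hits_def mean_hits_def g_def p_def sum_subtractf of_bool_def sum.If_cases)
  qed
  have "(\<Sum>e\<in>universal_reps n. (real (hits U a b e) - mean_hits n U a b)\<^sup>2) =
      (\<Sum>e\<in>universal_reps n. \<Sum>u\<in>U. \<Sum>v\<in>U. g u (e u) * g v (e v))"
    by (simp add: dev power2_eq_square sum_product)
  also have "\<dots> = (\<Sum>u\<in>U. \<Sum>v\<in>U. \<Sum>e\<in>universal_reps n. g u (e u) * g v (e v))"
    by (subst sum.swap, intro sum.cong refl, rule sum.swap)
  also have "\<dots> = (\<Sum>u\<in>U. \<Sum>e\<in>universal_reps n. g u (e u) * g u (e u))"
  proof (intro sum.cong refl)
    fix u assume u: "u \<in> U"
    have "(\<Sum>v\<in>U. \<Sum>e\<in>universal_reps n. g u (e u) * g v (e v)) =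
        (\<Sum>v\<in>U. if v = u then \<Sum>e\<in>universal_reps n. g u (e u) * g u (e u) else 0)"
    proof (intro sum.cong refl)
      fix v assume v: "v \<in> U"
      have uv: "u \<in> {1..n}" "v \<in> {1..n}" using u v U by auto
      show "(\<Sum>e\<in>universal_reps n. g u (e u) * g v (e v)) =
          (if v = u then \<Sum>e\<in>universal_reps n. g u (e u) * g u (e u) else 0)"
        using sum_universal_reps_centred[OF uv _ g0[OF u], of "g v"] by simp
    qed
    then show "(\<Sum>v\<in>U. \<Sum>e\<in>universal_reps n. g u (e u) * g v (e v)) =
        (\<Sum>e\<in>universal_reps n. g u (e u) * g u (e u))"
      using u finU by simp
  qed
  also have "\<dots> \<le> (\<Sum>u\<in>U. fact n * p u)"
    by (intro sum_mono g2)
  also have "\<dots> = fact n * mean_hits n U a b"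
    by (simp add: mean_hits_def p_def sum_distrib_left)
  finally show ?thesis .
qed

lemma hits_chebyshev:
  assumes U: "U \<subseteq> {1..n}" and c: "0 \<le> c"
  shows "real (card {e \<in> universal_reps n. c < \<bar>real (hits U a b e) - mean_hits n U a b\<bar>}) * c\<^sup>2
    \<le> fact n * mean_hits n U a b"
proof -
  let ?d = "\<lambda>e. real (hits U a b e) - mean_hits n U a b"
  let ?E = "{e \<in> universal_reps n. c < \<bar>?d e\<bar>}"
  have "c\<^sup>2 \<le> (?d e)\<^sup>2" if "e \<in> ?E" for e
    using that c by (intro abs_le_square_iff[THEN iffD1]) auto
  then have "real (card ?E) * c\<^sup>2 \<le> (\<Sum>e\<in>?E. (?d e)\<^sup>2)"
    using sum_bounded_below[of ?E "c\<^sup>2" "\<lambda>e. (?d e)\<^sup>2"] by simp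
  also have "\<dots> \<le> (\<Sum>e\<in>universal_reps n. (?d e)\<^sup>2)"
    by (intro sum_mono2 finite_universal_reps) auto
  also have "\<dots> \<le> fact n * mean_hits n U a b"
    by (rule hits_second_moment[OF U])
  finally show ?thesis .
qed

lemma markov_card:
  fixes f :: "'a \<Rightarrow> nat"
  assumes "finite A"
  shows "card {a \<in> A. c \<le> f a} * c \<le> (\<Sum>a\<in>A. f a)"
proof -
  have "card {a \<in> A. c \<le> f a} * c \<le> (\<Sum>a\<in>{a \<in> A. c \<le> f a}. f a)"
    using sum_bounded_below[of "{a \<in> A. c \<le> f a}" c f] by simp
  also have "\<dots> \<le> (\<Sum>a\<in>A. f a)"
    using assms by (intro sum_mono2) auto
  finally show ?thesis .
qed

lemma sum_card_filter_swap:
  assumes "finite A" "finite B"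
  shows "(\<Sum>a\<in>A. card {b \<in> B. P a b}) = (\<Sum>b\<in>B. card {a \<in> A. P a b})"
proof -
  have "(\<Sum>a\<in>A. card {b \<in> B. P a b}) = (\<Sum>a\<in>A. \<Sum>b\<in>B. if P a b then 1 else 0)"
    using sum_if_eq_card[OF assms(2)] by (simp only:)
  also have "\<dots> = (\<Sum>b\<in>B. \<Sum>a\<in>A. if P a b then 1 else 0)"
    by (rule sum.swap)
  also have "\<dots> = (\<Sum>b\<in>B. card {a \<in> A. P a b})"
    using sum_if_eq_card[OF assms(1)] by (simp only:)
  finally show ?thesis .
qed

section \<open>Regular inputs and nearly equal rank vectors\<close>

context grid
begin

text \<open>Only vertices below \<open>b\<close> contribute: at most 3n/4 of them, each with
  probability at most 4 (b - a) / n because at least n/4 endpoints are possible.\<close>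

lemma mean_hits_upper:
  assumes U: "U \<subseteq> {1..n}" and b: "a \<le> b" "b \<le> h + 1 + 2 * B * k"
  shows "mean_hits n U a b \<le> 3 * (real b - real a)"
proof (cases "b = 0")
  case True
  then show ?thesis using b by (simp add: mean_hits_def)
next
  case False
  have npos: "0 < n"
    using grid_end(1) B_pos k by (auto intro!: Nat.gr0I)
  have b4: "4 * (b - 1) \<le> 3 * n"
    using b(2) grid_end(1) by (simp add: h_def)
  have finU: "finite U" using U finite_subset by blast
  have "mean_hits n U a b \<le> (\<Sum>u\<in>U. if u < b then 4 * (real b - real a) / n else 0)"
    unfolding mean_hits_def
  proof (intro sum_mono)
    fix u assume u: "u \<in> U"
    show "real (card ({u..n} \<inter> {a..<b})) / real (Suc n - u) \<le>
        (if u < b then 4 * (real b - real a) / n else 0)"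
    proof (cases "u < b")
      case True
      have "card ({u..n} \<inter> {a..<b}) \<le> card {a..<b}" by (intro card_mono) auto
      then have "real (card ({u..n} \<inter> {a..<b})) \<le> real b - real a"
        using b(1) by (simp add: of_nat_diff[symmetric] del: of_nat_diff)
      moreover have "real n / 4 \<le> real (Suc n - u)"
        using True b4 u U by (auto simp: of_nat_diff)
      ultimately have "real (card ({u..n} \<inter> {a..<b})) / real (Suc n - u) \<le>
          (real b - real a) / (real n / 4)"
        using npos by (intro frac_le) auto
      then show ?thesis using True by (simp add: mult.commute)
    next
      case False
      then have "{u..n} \<inter> {a..<b} = {}" by auto
      then show ?thesis using False by simp
    qed
  qed
  also have "\<dots> = real (card (U \<inter> {..<b})) * (4 * (real b - real a) / n)"
    using finU by (simp add: sum.If_cases lessThan_def)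
  also have "\<dots> \<le> (3 * real n / 4) * (4 * (real b - real a) / n)"
  proof (rule mult_right_mono)
    have "card (U \<inter> {..<b}) \<le> card {1..<b}"
      using U by (intro card_mono) auto
    then have "4 * card (U \<inter> {..<b}) \<le> 3 * n" using b4 by simp
    then show "real (card (U \<inter> {..<b})) \<le> 3 * real n / 4" by linarith
  qed (use b in auto)
  also have "\<dots> = 3 * (real b - real a)"
    using npos by (simp add: field_simps)
  finally show ?thesis .
qed

text \<open>Each of the \<open>h \<ge> n / 3\<close> lower vertices ends in the block with
  probability at least 2 B / n.\<close>

lemma mean_hits_block_lower:
  assumes "j < k"
  shows "2 * real B / 3 \<le> mean_hits n {1..h} (start j) (start j + 2 * B)"
proof -
  have "2 * B * k \<ge> 2 * B * 1" using k by (intro mult_left_mono) auto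
  then have n3: "3 \<le> n" using grid_end(1) B_pos by linarith
  then have h3: "n \<le> 3 * h" by (simp add: h_def)
  have "2 * real B / 3 \<le> real h * (2 * real B / n)"
    using n3 h3 mult_right_mono[of "real n" "3 * real h" "real B"] by (simp add: field_simps)
  also have "\<dots> = (\<Sum>u\<in>{1..h}. 2 * real B / n)"
    by simp
  also have "\<dots> \<le> mean_hits n {1..h} (start j) (start j + 2 * B)"
    unfolding mean_hits_def
  proof (intro sum_mono)
    fix u assume u: "u \<in> {1..h}"
    then have "{u..n} \<inter> {start j..<start j + 2 * B} = {start j..<start j + 2 * B}"
      using block_le_n[OF assms] by (auto simp: start_def)
    then have "real (card ({u..n} \<inter> {start j..<start j + 2 * B})) = 2 * real B" by simp
    then show "2 * real B / n \<le>
        real (card ({u..n} \<inter> {start j..<start j + 2 * B})) / real (Suc n - u)"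
      using u h_le_n by (auto intro!: frac_le simp: of_nat_diff)
  qed
  finally show ?thesis .
qed

definition wild :: "(nat \<Rightarrow> nat) \<Rightarrow> (nat \<times> nat) set" where
  "wild e = {(j, i) \<in> {..<k} \<times> {..<y\<^sup>2}. real (40 * y) <
     \<bar>real (hits {1..n} (mid j) (mid j + i) e) - mean_hits n {1..n} (mid j) (mid j + i)\<bar>}"

definition thin :: "(nat \<Rightarrow> nat) \<Rightarrow> nat set" where
  "thin e = {j \<in> {..<k}. 3 * card (blk e j) < B}"

text \<open>In \<open>near_midranks\<close> the wild pairs of two inputs (1/64 each) and the changed
  ranks (1/32) add up to the fraction 1/16 in \<open>near\<close>. The thin blocks are charged
  later, when hits are counted.\<close>

definition regular :: "(nat \<Rightarrow> nat) \<Rightarrow> bool" where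
  "regular e \<longleftrightarrow> 64 * card (wild e) < k * y\<^sup>2 \<and> 16 * card (thin e) < k"

lemma y2_le_B: "y\<^sup>2 \<le> B" by (simp add: B_def)

text \<open>By Chebyshev's inequality a pair is wild with probability at most 3 y^2 / (40 y)^2 = 3 /
  1600, and Markov's inequality gives 64 * 3 / 1600 = 3 / 25 < 1 / 8.\<close>

lemma card_wild_large: "8 * card {e \<in> universal_reps n. k * y\<^sup>2 \<le> 64 * card (wild e)} \<le> fact n"
proof -
  define W where "W = {..<k} \<times> {..<y\<^sup>2}"
  define P where "P = (\<lambda>e (j, i). real (40 * y) <
     \<bar>real (hits {1..n} (mid j) (mid j + i) e) - mean_hits n {1..n} (mid j) (mid j + i)\<bar>)"
  have wild: "wild e = {p \<in> W. P e p}" for e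
    by (auto simp: wild_def W_def P_def)
  have each: "1600 * card {e \<in> universal_reps n. P e p} \<le> 3 * fact n" if "p \<in> W" for p
  proof -
    obtain j i where p: "p = (j, i)" by (cases p)
    with that have j: "j < k" and i: "i < y\<^sup>2" by (auto simp: W_def)
    have "real (card {e \<in> universal_reps n. P e p}) * (real (40 * y))\<^sup>2 \<le>
        fact n * mean_hits n {1..n} (mid j) (mid j + i)"
      using hits_chebyshev[of "{1..n}" n "real (40 * y)" "mid j" "mid j + i"] by (simp add: p P_def)
    also have "\<dots> \<le> fact n * (3 * real i)"
      using mean_hits_upper[of "{1..n}" "mid j" "mid j + i"] block_le_end[OF j] y2_le_B i
      by (intro mult_left_mono) (auto simp: mid_def)
    also have "\<dots> \<le> fact n * (3 * (real y)\<^sup>2)"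
      using i by (intro mult_left_mono) (auto simp: less_imp_le simp flip: of_nat_power)
    finally have "(1600 * real (card {e \<in> universal_reps n. P e p})) * (real y)\<^sup>2 \<le>
        (3 * fact n) * (real y)\<^sup>2"
      by (simp add: power_mult_distrib algebra_simps)
    then have "1600 * real (card {e \<in> universal_reps n. P e p}) \<le> 3 * fact n"
      using y by (simp add: mult_le_cancel_right)
    then have "real (1600 * card {e \<in> universal_reps n. P e p}) \<le> real (3 * fact n)"
      by simp
    then show ?thesis by (simp only: of_nat_le_iff)
  qed
  have "card {e \<in> universal_reps n. k * y\<^sup>2 \<le> 64 * card (wild e)} * (k * y\<^sup>2) \<le>
      (\<Sum>e\<in>universal_reps n. 64 * card (wild e))"
    by (rule markov_card[OF finite_universal_reps])
  also have "\<dots> = 64 * (\<Sum>p\<in>W. card {e \<in> universal_reps n. P e p})"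
    unfolding wild sum_distrib_left[symmetric]
    by (subst sum_card_filter_swap) (auto simp: finite_universal_reps W_def)
  finally have "25 * (card {e \<in> universal_reps n. k * y\<^sup>2 \<le> 64 * card (wild e)} * (k * y\<^sup>2)) \<le>
      (\<Sum>p\<in>W. 1600 * card {e \<in> universal_reps n. P e p})"
    unfolding sum_distrib_left[symmetric] by linarith
  also have "\<dots> \<le> (k * y\<^sup>2) * (3 * fact n)"
    using sum_bounded_above[of W "\<lambda>p. 1600 * card {e \<in> universal_reps n. P e p}", OF each]
    by (simp add: W_def)
  finally have "(k * y\<^sup>2) * (25 * card {e \<in> universal_reps n. k * y\<^sup>2 \<le> 64 * card (wild e)}) \<le>
      (k * y\<^sup>2) * (3 * fact n)"
    by (simp only: ac_simps)
  moreover have "0 < k * y\<^sup>2" using k y by simp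
  ultimately have "25 * card {e \<in> universal_reps n. k * y\<^sup>2 \<le> 64 * card (wild e)} \<le> 3 * fact n"
    by (simp only: mult_le_cancel1)
  then show ?thesis by linarith
qed

text \<open>A thin block deviates by more than B/3 from its mean, which is at least 2B/3 and at most
  6B. Its probability is at most 54 / B, and Markov's inequality gives 864 / B \<le> 1 / 8.\<close>

lemma card_thin_large: "8 * card {e \<in> universal_reps n. k \<le> 16 * card (thin e)} \<le> fact n"
proof -
  have each: "B * card {e \<in> universal_reps n. 3 * card (blk e j) < B} \<le> 54 * fact n"
    if "j \<in> {..<k}" for j
  proof -
    have j: "j < k" using that by simp
    let ?E = "{e \<in> universal_reps n. 3 * card (blk e j) < B}"
    let ?m = "mean_hits n {1..h} (start j) (start j + 2 * B)"
    have sub: "?E \<subseteq> {e \<in> universal_reps n. real B / 3 <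
        \<bar>real (hits {1..h} (start j) (start j + 2 * B) e) - ?m\<bar>}"
    proof
      fix e assume e: "e \<in> ?E"
      then have "real (3 * card (blk e j)) < real B" by (simp only: mem_Collect_eq of_nat_less_iff)
      then have "3 * real (hits {1..h} (start j) (start j + 2 * B) e) < real B"
        by (simp add: hits_def blk_def)
      then have "real B / 3 < \<bar>real (hits {1..h} (start j) (start j + 2 * B) e) - ?m\<bar>"
        using mean_hits_block_lower[OF j] by linarith
      with e show "e \<in> {e \<in> universal_reps n. real B / 3 <
        \<bar>real (hits {1..h} (start j) (start j + 2 * B) e) - ?m\<bar>}" by blast
    qed
    have "real (card ?E) * (real B / 3)\<^sup>2 \<le> real (card {e \<in> universal_reps n. real B / 3 <
        \<bar>real (hits {1..h} (start j) (start j + 2 * B) e) - ?m\<bar>}) * (real B / 3)\<^sup>2"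
      using sub finite_universal_reps by (intro mult_right_mono) (auto intro: card_mono)
    also have "\<dots> \<le> fact n * ?m"
      using h_le_n by (intro hits_chebyshev) auto
    also have "\<dots> \<le> fact n * (6 * real B)"
      using mean_hits_upper[of "{1..h}" "start j" "start j + 2 * B"] block_le_end[OF j] h_le_n
      by (intro mult_left_mono) auto
    finally have "real B * (real B * real (card ?E)) \<le> real B * (54 * fact n)"
      by (simp add: power2_eq_square field_simps)
    then have "real (B * card ?E) \<le> real (54 * fact n)"
      using B_pos by (simp add: mult_le_cancel_left)
    then show ?thesis by (simp only: of_nat_le_iff)
  qed
  have "card {e \<in> universal_reps n. k \<le> 16 * card (thin e)} * k \<le>
      (\<Sum>e\<in>universal_reps n. 16 * card (thin e))"
    by (rule markov_card[OF finite_universal_reps])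
  also have "\<dots> = 16 * (\<Sum>j\<in>{..<k}. card {e \<in> universal_reps n. 3 * card (blk e j) < B})"
    unfolding thin_def sum_distrib_left[symmetric]
    by (subst sum_card_filter_swap) (auto simp: finite_universal_reps)
  finally have "B * (card {e \<in> universal_reps n. k \<le> 16 * card (thin e)} * k) \<le>
      B * (16 * (\<Sum>j\<in>{..<k}. card {e \<in> universal_reps n. 3 * card (blk e j) < B}))"
    by (rule mult_left_mono) simp
  also have "\<dots> = 16 * (\<Sum>j\<in>{..<k}. B * card {e \<in> universal_reps n. 3 * card (blk e j) < B})"
    by (simp only: sum_distrib_left ac_simps)
  also have "\<dots> \<le> 16 * (k * (54 * fact n))"
    using sum_bounded_above[of "{..<k}" "\<lambda>j. B * card {e \<in> universal_reps n. 3 * card (blk e j) < B}",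
        OF each]
    by simp
  finally have "k * (B * card {e \<in> universal_reps n. k \<le> 16 * card (thin e)}) \<le> k * (864 * fact n)"
    by (simp add: ac_simps)
  then have le: "B * card {e \<in> universal_reps n. k \<le> 16 * card (thin e)} \<le> 864 * fact n"
    using k by (simp only: mult_le_cancel1)
  have "6912 * 1 \<le> 2 ^ 28 * y\<^sup>2" using y by (intro mult_mono) auto
  then have "6912 * card {e \<in> universal_reps n. k \<le> 16 * card (thin e)} \<le>
      B * card {e \<in> universal_reps n. k \<le> 16 * card (thin e)}"
    by (intro mult_right_mono) (auto simp: B_def)
  with le show ?thesis by linarith
qed

lemma card_irregular: "4 * card {e \<in> universal_reps n. \<not> regular e} \<le> fact n"
proof -
  have "{e \<in> universal_reps n. \<not> regular e} \<subseteq>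
      {e \<in> universal_reps n. k * y\<^sup>2 \<le> 64 * card (wild e)} \<union>
      {e \<in> universal_reps n. k \<le> 16 * card (thin e)}"
    by (auto simp: regular_def not_less)
  then have "card {e \<in> universal_reps n. \<not> regular e} \<le>
      card ({e \<in> universal_reps n. k * y\<^sup>2 \<le> 64 * card (wild e)} \<union>
      {e \<in> universal_reps n. k \<le> 16 * card (thin e)})"
    using finite_universal_reps by (intro card_mono) auto
  also note card_Un_le
  finally show ?thesis
    using card_wild_large card_thin_large by linarith
qed

text \<open>The radius allows a fluctuation of \<open>40 * y\<close> in each of two inputs. The
  relation is not transitive: three steps cost \<open>240 * y\<close> and 3k/16 blocks, which
  together with k/16 thin blocks still leaves the 3k/4 hits counted by
  \<open>spread\<close>.\<close>

definition near :: "(nat \<Rightarrow> int) \<Rightarrow> (nat \<Rightarrow> int) \<Rightarrow> bool" where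
  "near x x' \<longleftrightarrow> 16 * card {j \<in> {..<k}. 80 * int y < \<bar>x j - x' j\<bar>} \<le> k"

definition midranks :: "(nat \<Rightarrow> nat) \<Rightarrow> nat \<Rightarrow> int" where
  "midranks e j = int (endrank n e (mid j))"

lemma near_refl: "near x x"
  by (simp add: near_def)

lemma near_sym: "near x x' \<Longrightarrow> near x' x"
  by (simp add: near_def abs_minus_commute)

lemma endrank_add: "endrank n e (a + i) = endrank n e a + hits {1..n} a (a + i) e"
proof -
  have "{u \<in> {1..n}. e u < a + i} = {u \<in> {1..n}. e u < a} \<union> {u \<in> {1..n}. a \<le> e u \<and> e u < a + i}"
    by auto
  then show ?thesis
    unfolding endrank_def hits_def by (simp only:) (rule card_Un_disjoint; auto)
qed

text \<open>If the ranks of a middle differ by more than \<open>80 * y\<close>, they still differ at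
  each of the next \<open>y\<^sup>2\<close> positions, unless one of the counts in between is wild:
  tame counts are within \<open>40 * y\<close> of the same mean. Hence few changed ranks permit few
  such middles.\<close>

lemma near_midranks:
  assumes e: "regular e" "regular e'"
    and Z: "32 * card {v \<in> {1..n}. endrank n e v \<noteq> endrank n e' v} \<le> k * y\<^sup>2"
  shows "near (midranks e) (midranks e')"
proof -
  define J where "J = {j \<in> {..<k}. 80 * int y < \<bar>midranks e j - midranks e' j\<bar>}"
  define V where "V = {v \<in> {1..n}. endrank n e v \<noteq> endrank n e' v}"
  define D where "D = {(j, i) \<in> {..<k} \<times> {..<y\<^sup>2}. mid j + i \<in> V}"
  have sub: "J \<times> {..<y\<^sup>2} \<subseteq> wild e \<union> wild e' \<union> D"
  proof (clarify, rule ccontr)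
    fix j i assume j: "j \<in> J" and i: "i < y\<^sup>2" and D: "(j, i) \<notin> D"
      and w': "(j, i) \<notin> wild e'" and w: "(j, i) \<notin> wild e"
    have jk: "j < k" using j by (simp add: J_def)
    have v: "mid j + i \<in> {1..n}"
      using block_le_n[OF jk] i y2_le_B by (auto simp: mid_def start_def)
    with D jk i have "endrank n e (mid j + i) = endrank n e' (mid j + i)"
      by (auto simp: D_def V_def)
    then have "real (endrank n e (mid j)) + real (hits {1..n} (mid j) (mid j + i) e) =
        real (endrank n e' (mid j)) + real (hits {1..n} (mid j) (mid j + i) e')"
      unfolding endrank_add by (simp only: of_nat_add[symmetric])
    then have "\<bar>real (endrank n e (mid j)) - real (endrank n e' (mid j))\<bar> \<le> real (40 * y) + real (40 * y)"
      using w w' jk i by (simp add: wild_def not_less)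
    then have "real_of_int \<bar>midranks e j - midranks e' j\<bar> \<le> real_of_int (80 * int y)"
      by (simp add: midranks_def)
    then show False using j by (simp only: of_int_le_iff) (simp add: J_def)
  qed
  have inj: "inj_on (\<lambda>(j, i). mid j + i) D"
  proof (rule inj_onI, clarify)
    fix j i j' i' assume a: "(j, i) \<in> D" "(j', i') \<in> D" and eq: "mid j + i = mid j' + i'"
    have "i < 2 * B" "i' < 2 * B" using a y2_le_B by (auto simp: D_def)
    then have "j = j'"
      using eq start_less[of j j'] start_less[of j' j] by (cases j j' rule: linorder_cases) (auto simp: mid_def)
    with eq show "j = j' \<and> i = i'" by simp
  qed
  have "card D = card ((\<lambda>(j, i). mid j + i) ` D)"
    by (rule card_image[OF inj, symmetric])
  also have "\<dots> \<le> card V"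
    by (rule card_mono) (auto simp: D_def V_def)
  finally have DV: "32 * card D \<le> k * y\<^sup>2"
    using Z by (simp add: V_def)
  have fin: "finite (wild e)" "finite (wild e')" "finite D"
    by (auto simp: wild_def D_def intro: finite_subset[of _ "{..<k} \<times> {..<y\<^sup>2}"])
  have "card J * y\<^sup>2 = card (J \<times> {..<y\<^sup>2})"
    by (simp add: card_cartesian_product)
  also have "\<dots> \<le> card (wild e \<union> wild e' \<union> D)"
    using fin by (intro card_mono sub) auto
  also have "\<dots> \<le> card (wild e) + card (wild e') + card D"
    by (intro order_trans[OF card_Un_le] add_mono card_Un_le order_refl)
  finally have "16 * (card J * y\<^sup>2) \<le> k * y\<^sup>2"
    using DV e unfolding regular_def by linarith
  then have "(16 * card J) * y\<^sup>2 \<le> k * y\<^sup>2" by (simp only: mult.assoc)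
  then have "16 * card J \<le> k" by (rule mult_right_le_imp_le) (use y in simp)
  then show ?thesis by (simp add: near_def J_def)
qed

lemma card_near_midranks:
  "card {e \<in> universal_reps n. regular e \<and> (\<exists>x x'. near (midranks e) x \<and> near x x' \<and> near x' z)}
    * 2 ^ (2 * k) \<le> fact n"
proof -
  let ?H = "\<lambda>e. {j \<in> {..<k}. B \<le> 3 * card (blk e j) \<and>
      \<bar>int (endrank n e (mid j)) - z j\<bar> \<le> 240 * int y}"
  have "3 * k \<le> 4 * card (?H e)"
    if e: "regular e" and n3: "near (midranks e) x" "near x x'" "near x' z" for e x x'
  proof -
    let ?far = "\<lambda>f g :: nat \<Rightarrow> int. {j \<in> {..<k}. 80 * int y < \<bar>f j - g j\<bar>}"
    \<comment> \<open>By the triangle inequality a block is a hit unless it is thin or far in one of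
      the three steps.\<close>
    have "{..<k} \<subseteq> ?H e \<union> (thin e \<union> (?far (midranks e) x \<union> (?far x x' \<union> ?far x' z)))"
      by (auto simp: thin_def midranks_def)
    then have "card {..<k} \<le> card (?H e \<union> (thin e \<union> (?far (midranks e) x \<union> (?far x x' \<union> ?far x' z))))"
      by (intro card_mono) (auto simp: thin_def)
    also have "\<dots> \<le> card (?H e) + (card (thin e) + (card (?far (midranks e) x) +
        (card (?far x x') + card (?far x' z))))"
      by (intro order_trans[OF card_Un_le] add_mono order_refl)
    finally show ?thesis
      using n3 e unfolding near_def regular_def card_lessThan by linarith
  qed
  then have "card {e \<in> universal_reps n. regular e \<and>
      (\<exists>x x'. near (midranks e) x \<and> near x x' \<and> near x' z)} \<le>
      card {e \<in> universal_reps n. 3 * k \<le> 4 * card (?H e)}"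
    using finite_universal_reps by (intro card_mono) auto
  then have "card {e \<in> universal_reps n. regular e \<and>
      (\<exists>x x'. near (midranks e) x \<and> near x x' \<and> near x' z)} * 2 ^ (2 * k) \<le>
      card {e \<in> universal_reps n. 3 * k \<le> 4 * card (?H e)} * 2 ^ (2 * k)"
    by (rule mult_right_mono) simp
  also have "\<dots> \<le> fact n" by (rule spread)
  finally show ?thesis .
qed

end

text \<open>A small set is listed and padded with \<open>None\<close> to length \<open>g\<close>,
  which gives \<open>card A + 1\<close> choices per entry.\<close>

lemma card_small_subsets:
  assumes "finite A"
  shows "finite {X. X \<subseteq> A \<and> card X \<le> g}" "card {X. X \<subseteq> A \<and> card X \<le> g} \<le> Suc (card A) ^ g"
proof -
  let ?L = "{xs. set xs \<subseteq> insert None (Some ` A) \<and> length xs = g}"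
  show fin: "finite {X. X \<subseteq> A \<and> card X \<le> g}"
    using assms by simp
  have finL: "finite ?L" using assms by (intro finite_lists_length_eq) auto
  have "{X. X \<subseteq> A \<and> card X \<le> g} \<subseteq> (\<lambda>xs. {a. Some a \<in> set xs}) ` ?L"
  proof
    fix X assume "X \<in> {X. X \<subseteq> A \<and> card X \<le> g}"
    then have X: "X \<subseteq> A" "card X \<le> g" by auto
    obtain xs where xs: "set xs = X" "distinct xs"
      using finite_distinct_list finite_subset[OF X(1) assms] by blast
    define ys where "ys = map Some xs @ replicate (g - card X) None"
    have "length ys = g" using X xs distinct_card[of xs] by (simp add: ys_def)
    moreover have "set ys \<subseteq> insert None (Some ` A)" using X xs by (auto simp: ys_def)
    moreover have "X = {a. Some a \<in> set ys}" using xs by (auto simp: ys_def)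
    ultimately show "X \<in> (\<lambda>xs. {a. Some a \<in> set xs}) ` ?L" by blast
  qed
  then have "card {X. X \<subseteq> A \<and> card X \<le> g} \<le> card ?L"
    by (rule surj_card_le[OF finL])
  also have "\<dots> = card (insert None (Some ` A)) ^ g"
    using assms by (intro card_lists_length_eq) auto
  also have "card (insert None (Some ` A)) = Suc (card A)"
    using assms by (simp add: card_image)
  finally show "card {X. X \<subseteq> A \<and> card X \<le> g} \<le> Suc (card A) ^ g" .
qed

lemma large_fibre:
  assumes "finite A" "finite B" "f ` A \<subseteq> B" "card B \<le> N" "A \<noteq> {}"
  obtains b where "card A \<le> card {a \<in> A. f a = b} * N"
proof -
  have "\<exists>b. card A \<le> card {a \<in> A. f a = b} * N"
  proof (rule ccontr)
    assume "\<not> ?thesis"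
    then have less: "card {a \<in> A. f a = b} * N < card A" for b by (simp add: not_le)
    have "A = (\<Union>b\<in>B. {a \<in> A. f a = b})" using assms(3) by auto
    then have "card A \<le> (\<Sum>b\<in>B. card {a \<in> A. f a = b})"
      using card_UN_le[OF assms(2), of "\<lambda>b. {a \<in> A. f a = b}"] by simp
    then have "N * card A \<le> N * (\<Sum>b\<in>B. card {a \<in> A. f a = b})"
      by (rule mult_left_mono) simp
    also have "\<dots> = (\<Sum>b\<in>B. card {a \<in> A. f a = b} * N)"
      by (simp only: sum_distrib_left mult.commute)
    also have "\<dots> < card B * card A"
    proof (cases "B = {}")
      case False
      then show ?thesis
        using sum_strict_mono[OF assms(2) False, of "\<lambda>b. card {a \<in> A. f a = b} * N" "\<lambda>_. card A"] less
        by simp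
    qed (use assms in auto)
    also have "\<dots> \<le> N * card A" using assms(4) by (rule mult_right_mono) simp
    finally show False by simp
  qed
  with that show thesis by blast
qed

section \<open>Popular cells\<close>

locale interval_structure =
  fixes n w s t1 t2 :: nat and enc :: "(nat \<Rightarrow> nat) \<Rightarrow> word list"
    and adj_alg :: "nat \<Rightarrow> nat \<Rightarrow> bool query_alg" and deg_alg :: "nat \<Rightarrow> nat query_alg"
  assumes valid: "interval_graph_structure n w s t1 t2 enc adj_alg deg_alg"
    and n_pos: "0 < n"
begin

abbreviation foot where "foot \<equiv> footprint n enc adj_alg deg_alg"

lemma foot_sub: "e \<in> universal_reps n \<Longrightarrow> v \<in> {1..n} \<Longrightarrow> foot e v \<subseteq> {..<s}"
  and card_foot: "e \<in> universal_reps n \<Longrightarrow> v \<in> {1..n} \<Longrightarrow> card (foot e v) \<le> 2 * (t1 + t2)"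
  using footprint_bounds[OF valid] by blast+

lemma enc_tables: "e \<in> universal_reps n \<Longrightarrow> enc e \<in> tables s w"
  using valid by (simp add: interval_graph_structure_def)

definition visitors where "visitors e c = {v \<in> {1..n}. c \<in> foot e v}"

definition popular where "popular q e = {c \<in> {..<s}. n \<le> q * card (visitors e c)}"

definition touched where
  "touched q q' e = {v \<in> {1..n}. foot e v \<inter> (popular q' e - popular q e) \<noteq> {}}"

definition published where "published q e = (\<lambda>c. (c, enc e ! c)) ` popular q e"

lemma finite_popular: "finite (popular q e)"
  by (simp add: popular_def)

lemma popular_mono: "q \<le> q' \<Longrightarrow> popular q e \<subseteq> popular q' e"
  unfolding popular_def by (auto intro: order_trans mult_right_mono)

text \<open>Double counting of the incidences between cells and footprints.\<close>

lemma card_popular: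
  assumes e: "e \<in> universal_reps n"
  shows "card (popular q e) \<le> q * (2 * (t1 + t2))"
proof -
  have "card (popular q e) * n \<le> (\<Sum>c<s. q * card (visitors e c))"
    unfolding popular_def by (rule markov_card) simp
  also have "\<dots> = q * (\<Sum>v\<in>{1..n}. card {c \<in> {..<s}. c \<in> foot e v})"
    unfolding visitors_def sum_distrib_left[symmetric] by (subst sum_card_filter_swap) auto
  also have "\<dots> \<le> q * (\<Sum>v\<in>{1..n}. 2 * (t1 + t2))"
  proof (intro mult_left_mono sum_mono)
    fix v assume v: "v \<in> {1..n}"
    then have "{c \<in> {..<s}. c \<in> foot e v} = foot e v" using foot_sub[OF e] by auto
    then show "card {c \<in> {..<s}. c \<in> foot e v} \<le> 2 * (t1 + t2)" using card_foot[OF e v] by simp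
  qed simp
  finally have "card (popular q e) * n \<le> q * (2 * (t1 + t2)) * n"
    by (simp add: ac_simps)
  then show ?thesis using n_pos by simp
qed

text \<open>The layers of newly popular cells are disjoint, so a footprint meets at most as many
  layers as it has cells.\<close>

lemma touched_levels:
  assumes e: "e \<in> universal_reps n" and Q: "\<And>i j. i \<le> j \<Longrightarrow> Q i \<le> Q j"
  shows "(\<Sum>j<T. card (touched (Q j) (Q (Suc j)) e)) \<le> n * (2 * (t1 + t2))"
proof -
  define layer where "layer = (\<lambda>j. popular (Q (Suc j)) e - popular (Q j) e)"
  have unique: "i = j" if "c \<in> layer i" "c \<in> layer j" for c i j
  proof (rule ccontr)
    assume "i \<noteq> j"
    then consider "Suc i \<le> j" | "Suc j \<le> i" by linarith
    then show False
      using that popular_mono[OF Q, of "Suc i" j e] popular_mono[OF Q, of "Suc j" i e]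
      by cases (auto simp: layer_def)
  qed
  have "card {j \<in> {..<T}. foot e v \<inter> layer j \<noteq> {}} \<le> 2 * (t1 + t2)" if v: "v \<in> {1..n}" for v
  proof -
    have fin: "finite (foot e v)" by (simp add: footprint_def)
    have "{j \<in> {..<T}. foot e v \<inter> layer j \<noteq> {}} \<subseteq> (\<lambda>c. SOME j. c \<in> layer j) ` foot e v"
    proof
      fix j assume "j \<in> {j \<in> {..<T}. foot e v \<inter> layer j \<noteq> {}}"
      then obtain c where c: "c \<in> foot e v" "c \<in> layer j" by auto
      then have "(SOME j. c \<in> layer j) = j" using unique by (intro some_equality) auto
      with c show "j \<in> (\<lambda>c. SOME j. c \<in> layer j) ` foot e v" by force
    qed
    then have "card {j \<in> {..<T}. foot e v \<inter> layer j \<noteq> {}} \<le> card (foot e v)"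
      by (rule surj_card_le[OF fin])
    with card_foot[OF e v] show ?thesis by simp
  qed
  then have "(\<Sum>v\<in>{1..n}. card {j \<in> {..<T}. foot e v \<inter> layer j \<noteq> {}}) \<le> n * (2 * (t1 + t2))"
    using sum_bounded_above[of "{1..n}" "\<lambda>v. card {j \<in> {..<T}. foot e v \<inter> layer j \<noteq> {}}"] by simp
  moreover have "(\<Sum>v\<in>{1..n}. card {j \<in> {..<T}. foot e v \<inter> layer j \<noteq> {}}) =
      (\<Sum>j<T. card (touched (Q j) (Q (Suc j)) e))"
    unfolding touched_def layer_def by (rule sum_card_filter_swap) auto
  ultimately show ?thesis by simp
qed

text \<open>Otherwise, on every level, more than a quarter of the inputs would have more than n /
  2^39 touched vertices, and the sum over \<open>T\<close> levels would exceed
  \<open>touched_levels\<close>, as 4 * 2^39 = 2^41. The number of levels, linear in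
  \<open>t1 + t2\<close>, becomes the exponent of the lower bound.\<close>

lemma quiet_level:
  assumes Q: "\<And>i j. i \<le> j \<Longrightarrow> Q i \<le> Q j" and T: "2 ^ 41 * (2 * (t1 + t2)) \<le> T" "0 < T"
  shows "\<exists>j<T. 4 * card {e \<in> universal_reps n. n < 2 ^ 39 * card (touched (Q j) (Q (Suc j)) e)}
    \<le> fact n"
proof (rule ccontr)
  define g where "g = (\<lambda>j e. 2 ^ 39 * card (touched (Q j) (Q (Suc j)) e))"
  assume "\<not> ?thesis"
  then have many: "fact n < 4 * card {e \<in> universal_reps n. n < g j e}" if "j < T" for j
    using that by (auto simp: g_def not_le)
  have "T * (n * fact n) = (\<Sum>j<T. n * fact n)" by simp
  also have "\<dots> < (\<Sum>j<T. 4 * (\<Sum>e\<in>universal_reps n. g j e))"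
  proof (rule sum_strict_mono)
    fix j assume "j \<in> {..<T}"
    then have "n * fact n < n * (4 * card {e \<in> universal_reps n. n < g j e})"
      using many[of j] n_pos by (intro mult_strict_left_mono) auto
    also have "\<dots> = 4 * (card {e \<in> universal_reps n. n < g j e} * n)" by simp
    also have "\<dots> \<le> 4 * (card {e \<in> universal_reps n. n \<le> g j e} * n)"
      using finite_universal_reps by (intro mult_left_mono mult_right_mono card_mono) auto
    also have "\<dots> \<le> 4 * (\<Sum>e\<in>universal_reps n. g j e)"
      by (intro mult_left_mono markov_card finite_universal_reps) simp
    finally show "n * fact n < 4 * (\<Sum>e\<in>universal_reps n. g j e)" .
  qed (use T in auto)
  also have "\<dots> = 2 ^ 41 * (\<Sum>j<T. \<Sum>e\<in>universal_reps n. card (touched (Q j) (Q (Suc j)) e))"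
    by (simp add: g_def sum_distrib_left)
  also have "(\<Sum>j<T. \<Sum>e\<in>universal_reps n. card (touched (Q j) (Q (Suc j)) e)) =
      (\<Sum>e\<in>universal_reps n. \<Sum>j<T. card (touched (Q j) (Q (Suc j)) e))"
    by (rule sum.swap)
  also have "2 ^ 41 * \<dots> \<le> 2 ^ 41 * (fact n * (n * (2 * (t1 + t2))))"
    using sum_bounded_above[of "universal_reps n" "\<lambda>e. \<Sum>j<T. card (touched (Q j) (Q (Suc j)) e)"]
      touched_levels[of _ Q T] Q by (intro mult_left_mono) (auto simp: card_universal_reps)
  also have "\<dots> = (2 ^ 41 * (2 * (t1 + t2))) * (n * fact n)"
    by (simp only: ac_simps)
  also have "\<dots> \<le> T * (n * fact n)"
    by (rule mult_right_mono[OF T(1)]) simp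
  finally show False by simp
qed

lemma published_sub:
  assumes "e \<in> universal_reps n"
  shows "published q e \<subseteq> {..<s} \<times> {c. set c \<subseteq> UNIV \<and> length c = w}"
    "card (published q e) \<le> q * (2 * (t1 + t2))"
proof -
  show "published q e \<subseteq> {..<s} \<times> {c. set c \<subseteq> UNIV \<and> length c = w}"
    using enc_tables[OF assms] by (auto simp: published_def popular_def tables_def)
  have "card (published q e) \<le> card (popular q e)"
    unfolding published_def by (rule card_image_le[OF finite_popular])
  with card_popular[OF assms, of q] show "card (published q e) \<le> q * (2 * (t1 + t2))"
    by (rule order_trans[rotated])
qed

text \<open>
  Two valid tables with the same published cells which differ in few cells have the same ranks almost
  everywhere: a footprint on which they differ contains either a cell that is popular only on the
  higher level, or an unpopular cell among those few.
\<close>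

lemma card_rank_changes:
  assumes e: "e \<in> universal_reps n" "e' \<in> universal_reps n"
    and pub: "published q e = published q e'"
    and D: "finite D" "card D \<le> 2 * b" "\<And>c. c < s \<Longrightarrow> c \<notin> D \<Longrightarrow> enc e ! c = enc e' ! c"
    and b: "0 < b" "2 ^ 40 * b \<le> q'"
    and quiet: "2 ^ 39 * card (touched q q' e) \<le> n"
  shows "2 ^ 38 * card {v \<in> {1..n}. endrank n e v \<noteq> endrank n e' v} \<le> n"
proof -
  \<comment> \<open>The guard is there because \<open>popular\<close> contains only addresses below
    \<open>s\<close> and so controls no others.\<close>
  define U where "U = (\<Union>c\<in>D - popular q' e. if c < s then visitors e c else {})"
  have "{v \<in> {1..n}. endrank n e v \<noteq> endrank n e' v} \<subseteq> touched q q' e \<union> U"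
  proof
    fix v assume "v \<in> {v \<in> {1..n}. endrank n e v \<noteq> endrank n e' v}"
    then have v: "v \<in> {1..n}" "endrank n e v \<noteq> endrank n e' v" by auto
    then obtain c where c: "c \<in> foot e v" "enc e ! c \<noteq> enc e' ! c"
      using footprint_certificate(2)[OF valid e v(1)] by blast
    have cs: "c < s" using c foot_sub[OF e(1) v(1)] by auto
    have "c \<in> D" using D(3)[OF cs] c by blast
    moreover have "c \<notin> popular q e"
    proof
      assume "c \<in> popular q e"
      then have "(c, enc e ! c) \<in> published q e"
        unfolding published_def by (rule imageI)
      then have "(c, enc e ! c) \<in> published q e'" by (simp only: pub)
      then show False using c by (auto simp: published_def)
    qed
    ultimately show "v \<in> touched q q' e \<union> U"
      using c v cs by (auto simp: touched_def U_def visitors_def)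
  qed
  moreover have finU: "finite U" "finite (touched q q' e)"
    using D(1) by (auto simp: U_def visitors_def touched_def)
  ultimately have "card {v \<in> {1..n}. endrank n e v \<noteq> endrank n e' v} \<le> card (touched q q' e \<union> U)"
    by (intro card_mono) auto
  also have "\<dots> \<le> card (touched q q' e) + card U" by (rule card_Un_le)
  finally have split: "card {v \<in> {1..n}. endrank n e v \<noteq> endrank n e' v} \<le>
      card (touched q q' e) + card U" .
  \<comment> \<open>An unpopular cell has fewer than n / q' visitors, so the at most
    \<open>2 * b\<close> cells of \<open>D\<close> reach at most n / 2^39 vertices.\<close>
  have "q' * card U \<le> q' * (\<Sum>c\<in>D - popular q' e. card (if c < s then visitors e c else {}))"
    unfolding U_def using D(1) by (intro mult_left_mono card_UN_le) auto
  also have "\<dots> = (\<Sum>c\<in>D - popular q' e. q' * card (if c < s then visitors e c else {}))"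
    by (rule sum_distrib_left)
  also have "\<dots> \<le> card (D - popular q' e) * n"
  proof -
    have "q' * card (if c < s then visitors e c else {}) \<le> n" if "c \<in> D - popular q' e" for c
      using that by (auto simp: popular_def)
    from sum_bounded_above[of "D - popular q' e", OF this] show ?thesis by simp
  qed
  also have "\<dots> \<le> (2 * b) * n"
    using D card_mono[OF D(1), of "D - popular q' e"] by (intro mult_right_mono) auto
  finally have "q' * card U \<le> (2 * b) * n" .
  moreover have "2 ^ 40 * b * card U \<le> q' * card U"
    using b(2) by (rule mult_right_mono) simp
  ultimately have "2 ^ 40 * b * card U \<le> (2 * b) * n" by (rule order_trans[rotated])
  moreover have "2 ^ 40 * b * card U = (2 * b) * (2 ^ 39 * card U)" by simp
  ultimately have "(2 * b) * (2 ^ 39 * card U) \<le> (2 * b) * n" by (simp only:)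
  then have "2 ^ 39 * card U \<le> n" using b(1) by simp
  with split quiet show ?thesis by simp
qed

end

section \<open>Counting the tables that share one publication\<close>

lemma (in grid) near_cong:
  assumes "\<And>j. j < k \<Longrightarrow> x j = x\<^sub>1 j" "\<And>j. j < k \<Longrightarrow> x' j = x\<^sub>2 j"
  shows "near x x' \<longleftrightarrow> near x\<^sub>1 x\<^sub>2"
proof -
  have "{j \<in> {..<k}. 80 * int y < \<bar>x j - x' j\<bar>} = {j \<in> {..<k}. 80 * int y < \<bar>x\<^sub>1 j - x\<^sub>2 j\<bar>}"
    using assms by auto
  then show ?thesis by (simp add: near_def)
qed

text \<open>Together \<open>size\<close> and \<open>n_upper\<close> fix \<open>y\<^sup>2\<close> as
  n / k up to constants. The level \<open>q'\<close> is matched to the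
  \<open>2 * (k * d\<^sup>2)\<close> cells of two transcripts of \<open>k\<close> rank
  queries.\<close>

locale structure_grid = interval_structure + grid +
  fixes d q q' :: nat
  assumes depth: "n \<le> 2 ^ d" "t1 + t2 \<le> d" "0 < d"
    and n_upper: "n \<le> 2 ^ 33 * k * y\<^sup>2"
    and q': "2 ^ 40 * (k * d\<^sup>2) \<le> q'"
    and quiet: "4 * card {e \<in> universal_reps n. n < 2 ^ 39 * card (touched q q' e)} \<le> fact n"
begin

abbreviation rank where "rank j \<equiv> rank_alg n d adj_alg deg_alg (mid j)"

definition transcript where "transcript M = (\<Union>j<k. set (probes (rank j) M))"

text \<open>The value 0 beyond \<open>k\<close> makes \<open>ranks\<close> as a whole function
  depend on the transcript contents alone, as \<open>rerouting_bound\<close> demands.\<close>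

definition ranks :: "word list \<Rightarrow> nat \<Rightarrow> int" where
  "ranks M j = (if j < k then int (result (rank j) M) else 0)"

lemma mid_bounds: "j < k \<Longrightarrow> mid j \<in> {1..n}"
  using block_le_n[of j] B_pos by (auto simp: mid_def start_def)

lemma rank_within:
  "e \<in> universal_reps n \<Longrightarrow> j < k \<Longrightarrow>
    answers_within (rank j) (enc e) (endrank n e (mid j)) (t2 + d * t1)"
  by (intro rank_alg_correct[OF valid] mid_bounds depth(1))

lemma ranks_enc: "e \<in> universal_reps n \<Longrightarrow> j < k \<Longrightarrow> ranks (enc e) j = midranks e j"
  using rank_within[of e j] by (simp add: answers_within_def ranks_def midranks_def)

lemma transcript_sub: "e \<in> universal_reps n \<Longrightarrow> transcript (enc e) \<subseteq> {..<s}"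
  using rank_within[of e] enc_tables[of e] by (force simp: answers_within_def transcript_def tables_def)

text \<open>One rank query makes at most
  \<open>t2 + d * t1 \<le> d * (t1 + t2) \<le> d\<^sup>2\<close> probes.\<close>

lemma card_transcript:
  assumes "e \<in> universal_reps n" shows "card (transcript (enc e)) \<le> k * d\<^sup>2"
proof -
  have "t2 + d * t1 \<le> d * t2 + d * t1" using depth(3) by simp
  also have "\<dots> \<le> d * d" using depth(2) by (simp add: add_mult_distrib2[symmetric] add.commute)
  finally have td: "t2 + d * t1 \<le> d\<^sup>2" by (simp add: power2_eq_square)
  have "card (set (probes (rank j) (enc e))) \<le> d\<^sup>2" if "j < k" for j
    using rank_within[OF assms that] card_length[of "probes (rank j) (enc e)"] td
    by (simp add: answers_within_def)
  then have "(\<Sum>j<k. card (set (probes (rank j) (enc e)))) \<le> k * d\<^sup>2"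
    using sum_bounded_above[of "{..<k}" "\<lambda>j. card (set (probes (rank j) (enc e)))"] by simp
  moreover have "card (transcript (enc e)) \<le> (\<Sum>j<k. card (set (probes (rank j) (enc e))))"
    unfolding transcript_def by (rule card_UN_le) simp
  ultimately show ?thesis by simp
qed

lemma ranks_closed:
  assumes "\<And>i. i \<in> transcript M \<Longrightarrow> M ! i = M' ! i"
  shows "transcript M' = transcript M \<and> ranks M' = ranks M"
proof -
  have "probes (rank j) M' = probes (rank j) M \<and> result (rank j) M' = result (rank j) M" if "j < k" for j
    using assms that by (intro query_alg_cong) (auto simp: transcript_def)
  then show ?thesis by (auto simp: transcript_def ranks_def fun_eq_iff)
qed

definition good where
  "good = {e \<in> universal_reps n. regular e \<and> 2 ^ 39 * card (touched q q' e) \<le> n}"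

lemma finite_good: "finite good" and good_sub: "good \<subseteq> universal_reps n"
  using finite_universal_reps by (auto simp: good_def)

lemma card_good: "fact n \<le> 2 * card good"
proof -
  have "universal_reps n \<subseteq> good \<union> ({e \<in> universal_reps n. \<not> regular e} \<union>
      {e \<in> universal_reps n. n < 2 ^ 39 * card (touched q q' e)})"
    by (auto simp: good_def not_le)
  then have "card (universal_reps n) \<le> card (good \<union> ({e \<in> universal_reps n. \<not> regular e} \<union>
      {e \<in> universal_reps n. n < 2 ^ 39 * card (touched q q' e)}))"
    using finite_good finite_universal_reps by (intro card_mono) auto
  also have "\<dots> \<le> card good + (card {e \<in> universal_reps n. \<not> regular e} +
      card {e \<in> universal_reps n. n < 2 ^ 39 * card (touched q q' e)})"
    by (intro order_trans[OF card_Un_le] add_mono card_Un_le order_refl)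
  finally show ?thesis
    using card_irregular quiet unfolding card_universal_reps by linarith
qed

text \<open>Outside the two transcripts both tables equal the background, so
  \<open>card_rank_changes\<close> applies. By \<open>n_upper\<close> its n / 2^38 changed ranks
  stay within the k y^2 / 32 that \<open>near_midranks\<close> tolerates.\<close>

lemma near_ranks:
  assumes e: "e \<in> good" "e' \<in> good" and pub: "published q e = published q e'"
    and M: "\<And>i. i < s \<Longrightarrow> i \<notin> transcript (enc e) \<Longrightarrow> enc e ! i = M ! i"
      "\<And>i. i < s \<Longrightarrow> i \<notin> transcript (enc e') \<Longrightarrow> enc e' ! i = M ! i"
  shows "near (ranks (enc e)) (ranks (enc e'))"
proof -
  have er: "e \<in> universal_reps n" "e' \<in> universal_reps n" using e good_sub by auto
  let ?D = "transcript (enc e) \<union> transcript (enc e')"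
  have "2 ^ 38 * card {v \<in> {1..n}. endrank n e v \<noteq> endrank n e' v} \<le> n"
  proof (rule card_rank_changes[OF er pub, of ?D "k * d\<^sup>2"])
    show "finite ?D" by (simp add: transcript_def)
    show "card ?D \<le> 2 * (k * d\<^sup>2)"
      using card_Un_le[of "transcript (enc e)" "transcript (enc e')"]
        card_transcript[OF er(1)] card_transcript[OF er(2)] by linarith
    show "enc e ! c = enc e' ! c" if "c < s" "c \<notin> ?D" for c
      using M(1)[of c] M(2)[of c] that by simp
    show "0 < k * d\<^sup>2" using k depth(3) by simp
    show "2 ^ 40 * (k * d\<^sup>2) \<le> q'" by (rule q')
    show "2 ^ 39 * card (touched q q' e) \<le> n" using e(1) by (simp add: good_def)
  qed
  then have "32 * card {v \<in> {1..n}. endrank n e v \<noteq> endrank n e' v} \<le> k * y\<^sup>2"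
    using n_upper by simp
  then have "near (midranks e) (midranks e')"
    using e by (intro near_midranks) (auto simp: good_def)
  then show ?thesis
    using near_cong[of "ranks (enc e)" "midranks e" "ranks (enc e')" "midranks e'"]
      ranks_enc[OF er(1)] ranks_enc[OF er(2)] by simp
qed

text \<open>A publication is a set of at most \<open>q * (2 * (t1 + t2))\<close> addresses with
  contents, hence one of at most \<open>N\<close>, and some class \<open>A\<close> of good inputs
  has at least n! / (2 N) members. Then \<open>rerouting_bound\<close>, with \<open>K\<close> at
  most n! / 4^k by \<open>card_near_midranks\<close>, bounds the square of
  \<open>card A\<close>.\<close>

lemma counting_bound:
  "2 ^ (2 * k) * fact n \<le> 16 * 2 ^ (s * w) * (((s * 2 ^ w + 1) ^ (q * (2 * (t1 + t2))))\<^sup>2)"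
proof -
  define N where "N = (s * 2 ^ w + 1) ^ (q * (2 * (t1 + t2)))"
  define C where "C = {..<s} \<times> {c. set c \<subseteq> (UNIV :: bool set) \<and> length c = w}"
  have finC: "finite C"
    unfolding C_def by (intro finite_cartesian_product finite_lists_length_eq) auto
  have cardC: "card C = s * 2 ^ w"
    using card_lists_length_eq[of "UNIV :: bool set" w] by (simp add: C_def card_cartesian_product)
  define P where "P = {X. X \<subseteq> C \<and> card X \<le> q * (2 * (t1 + t2))}"
  have P: "finite P" "card P \<le> N"
    using card_small_subsets[OF finC] by (auto simp: P_def N_def cardC)
  have "published q ` good \<subseteq> P"
  proof
    fix X assume "X \<in> published q ` good"
    then obtain e where "e \<in> universal_reps n" "X = published q e" using good_sub by blast
    then show "X \<in> P" using published_sub[of e q] by (simp add: P_def C_def)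
  qed
  moreover have "good \<noteq> {}"
  proof
    assume "good = {}"
    with card_good have "(fact n :: nat) \<le> 0" by simp
    then show False by simp
  qed
  ultimately obtain b where b: "card good \<le> card {e \<in> good. published q e = b} * N"
    using large_fibre[OF finite_good P(1) _ P(2)] by blast
  define A where "A = {e \<in> good. published q e = b}"
  have A: "A \<subseteq> good" "A \<subseteq> universal_reps n" using good_sub by (auto simp: A_def)
  have inj: "inj_on enc A" using structure_inj_on[OF valid] A(2) by (rule inj_on_subset)
  define K where "K = fact n div (2 ^ (2 * k) :: nat)"
  have "(card (enc ` A))\<^sup>2 \<le> 4 * 2 ^ (s * w) * K"
  proof (rule rerouting_bound[where F = transcript and X = ranks and near = near])
    show "enc ` A \<subseteq> tables s w" using enc_tables A(2) by blast
    show "transcript M \<subseteq> {..<s}" if "M \<in> enc ` A" for M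
      using that transcript_sub A(2) by blast
    show "transcript Q = transcript M \<and> ranks Q = ranks M"
      if "\<And>i. i \<in> transcript M \<Longrightarrow> M ! i = Q ! i" for M Q
      using that by (rule ranks_closed)
    show "near x x" for x by (rule near_refl)
    show "near x y \<Longrightarrow> near y x" for x y by (rule near_sym)
    show "near (ranks M) (ranks M')"
      if "M \<in> enc ` A" "M' \<in> enc ` A"
        "\<And>i. i < s \<Longrightarrow> i \<notin> transcript M \<Longrightarrow> M ! i = Q ! i"
        "\<And>i. i < s \<Longrightarrow> i \<notin> transcript M' \<Longrightarrow> M' ! i = Q ! i" for M M' Q
    proof -
      from that(1,2) obtain e e' where e: "e \<in> A" "e' \<in> A" "M = enc e" "M' = enc e'" by blast
      show ?thesis
        unfolding e(3,4)
      proof (rule near_ranks)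
        show "e \<in> good" "e' \<in> good" "published q e = published q e'"
          using e(1,2) by (auto simp: A_def)
      qed (use that(3,4) e(3,4) in auto)
    qed
    show "card {M \<in> enc ` A. \<exists>x y. near (ranks M) x \<and> near x y \<and> near y (ranks M\<^sub>0)} \<le> K" for M\<^sub>0
    proof -
      let ?E = "{e \<in> universal_reps n. regular e \<and>
        (\<exists>x x'. near (midranks e) x \<and> near x x' \<and> near x' (ranks M\<^sub>0))}"
      have sub: "{M \<in> enc ` A. \<exists>x y. near (ranks M) x \<and> near x y \<and> near y (ranks M\<^sub>0)} \<subseteq> enc ` ?E"
      proof
        fix M assume "M \<in> {M \<in> enc ` A. \<exists>x y. near (ranks M) x \<and> near x y \<and> near y (ranks M\<^sub>0)}"
        then obtain e x y where e: "e \<in> A" "M = enc e"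
          and n3: "near (ranks M) x" "near x y" "near y (ranks M\<^sub>0)" by blast
        have "near (midranks e) x"
          using near_cong[of "ranks M" "midranks e" x x] ranks_enc[of e] e n3(1) A(2) by auto
        then have "e \<in> ?E" using e(1) A n3 by (auto simp: good_def)
        then show "M \<in> enc ` ?E" using e(2) by blast
      qed
      have fin: "finite ?E" using finite_universal_reps by simp
      have "card {M \<in> enc ` A. \<exists>x y. near (ranks M) x \<and> near x y \<and> near y (ranks M\<^sub>0)} \<le> card (enc ` ?E)"
        by (rule card_mono[OF finite_imageI[OF fin] sub])
      also have "\<dots> \<le> card ?E" by (rule card_image_le[OF fin])
      also have "\<dots> \<le> K"
        unfolding K_def using card_near_midranks[of "ranks M\<^sub>0"] by (simp add: less_eq_div_iff_mult_less_eq)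
      finally show ?thesis .
    qed
  qed
  moreover have "card (enc ` A) = card A" by (rule card_image[OF inj])
  ultimately have A2: "(card A)\<^sup>2 \<le> 4 * 2 ^ (s * w) * K" by simp
  have K: "2 ^ (2 * k) * K \<le> fact n" unfolding K_def by (rule times_div_less_eq_dividend)
  have "fact n \<le> 2 * (card A * N)"
    using card_good b unfolding A_def by linarith
  then have "(fact n :: nat)\<^sup>2 \<le> (2 * (card A * N))\<^sup>2"
    by (rule power_mono) simp
  also have "\<dots> = 4 * N\<^sup>2 * (card A)\<^sup>2"
    by (simp add: power_mult_distrib)
  also have "\<dots> \<le> 4 * N\<^sup>2 * (4 * 2 ^ (s * w) * K)"
    by (rule mult_left_mono[OF A2]) simp
  finally have "2 ^ (2 * k) * (fact n)\<^sup>2 \<le> 2 ^ (2 * k) * (4 * N\<^sup>2 * (4 * 2 ^ (s * w) * K))"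
    by (rule mult_left_mono) simp
  also have "\<dots> = (16 * 2 ^ (s * w) * N\<^sup>2) * (2 ^ (2 * k) * K)"
    by simp
  also have "\<dots> \<le> (16 * 2 ^ (s * w) * N\<^sup>2) * fact n"
    by (rule mult_left_mono[OF K]) simp
  finally have "(2 ^ (2 * k) * fact n) * fact n \<le> (16 * 2 ^ (s * w) * N\<^sup>2) * fact n"
    by (simp only: power2_eq_square mult.assoc)
  then have "2 ^ (2 * k) * fact n \<le> 16 * 2 ^ (s * w) * N\<^sup>2"
    by (rule mult_right_le_imp_le) simp
  then show ?thesis by (simp only: N_def)
qed

end


section \<open>The lower bound\<close>

text \<open>Otherwise all levels \<open>r * g ^ j\<close> with \<open>j \<le> T\<close> are at most
  \<open>n\<close> and one of them is quiet. On that level \<open>counting_bound\<close> gains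
  \<open>2 * k\<close> bits, more than the redundancy and the publication can pay for.\<close>

lemma (in interval_structure) redundancy_exceeds:
  assumes t: "0 < t1 + t2" "t1 + t2 \<le> d" and d: "0 < d" "n \<le> 2 ^ d"
    and w: "w \<le> a * d" and s: "s \<le> 2 ^ (2 * d)" and r: "0 < r" "2 ^ (s * w) \<le> 2 ^ r * (fact n :: nat)"
    and g: "2 ^ 40 * (2 * a + 10) * d ^ 4 \<le> g"
  shows "n < r * g ^ (2 ^ 41 * (2 * (t1 + t2)))"
proof (rule ccontr)
  define T where "T = 2 ^ 41 * (2 * (t1 + t2))"
  assume "\<not> n < r * g ^ (2 ^ 41 * (2 * (t1 + t2)))"
  then have n: "r * g ^ T \<le> n" by (simp only: T_def not_less)
  have "0 < 2 ^ 40 * (2 * a + 10) * d ^ 4" using d(1) by simp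
  then have g0: "0 < g" using g by (rule less_le_trans)
  define Q where "Q = (\<lambda>j. r * g ^ j)"
  have Q: "Q i \<le> Q j" if "i \<le> j" for i j
    unfolding Q_def using that g0 by (intro mult_left_mono power_increasing) auto
  have "0 < T" using t(1) by (simp add: T_def)
  then obtain j where j: "j < T"
    and quiet: "4 * card {e \<in> universal_reps n. n < 2 ^ 39 * card (touched (Q j) (Q (Suc j)) e)} \<le> fact n"
    using quiet_level[of Q T] Q by (auto simp: T_def)
  define q where "q = Q j"
  have rq: "r \<le> q" using g0 by (simp add: q_def Q_def)
  \<comment> \<open>Chosen so that \<open>2 * k = (20 + 4 * a) * (q * d\<^sup>2)\<close> exceeds
    \<open>4 + r\<close> plus the \<open>(12 + 4 * a) * (q * d\<^sup>2)\<close> bits allowed for the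
    squared number of publications, while \<open>2 ^ 40 * (k * d\<^sup>2)\<close> is still at most
    the next level \<open>q * g\<close>.\<close>
  define k where "k = q * (2 * a + 10) * d\<^sup>2"
  have k: "0 < k" using rq r d by (simp add: k_def)
  have "2 ^ 40 * (k * d\<^sup>2) = q * (2 ^ 40 * (2 * a + 10) * d ^ 4)"
    by (simp add: k_def power2_eq_square power4_eq_xxxx)
  also have "\<dots> \<le> q * g" by (rule mult_left_mono[OF g]) simp
  also have "\<dots> = Q (Suc j)" by (simp add: q_def Q_def)
  finally have q': "2 ^ 40 * (k * d\<^sup>2) \<le> Q (Suc j)" .
  have Qn: "Q (Suc j) \<le> n"
    using Q[of "Suc j" T] j n unfolding Q_def by linarith
  have "2 ^ 31 * (k * 1) \<le> 2 ^ 40 * (k * d\<^sup>2)" using d(1) by (intro mult_mono) auto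
  then have kn: "2 ^ 31 * k \<le> n" using q' Qn unfolding mult_1_right by (rule order_trans[OF _ order_trans])
  \<comment> \<open>Its predecessor \<open>y\<close> is the largest value that \<open>size\<close>
    permits. As \<open>Y \<ge> 2\<close>, also \<open>Y \<le> 2 * y\<close>, which costs the factor
    4 between \<open>2 ^ 31\<close> and \<open>2 ^ 33\<close>.\<close>
  define Y where "Y = (LEAST y. n < 2 ^ 31 * k * y\<^sup>2)"
  have "n < 2 ^ 31 * k * (Suc n)\<^sup>2"
  proof -
    have "1 * n < 2 ^ 31 * k * (Suc n)\<^sup>2"
      using k by (intro mult_le_less_imp_less) (auto simp: power2_eq_square)
    then show ?thesis by simp
  qed
  then have Y: "n < 2 ^ 31 * k * Y\<^sup>2" unfolding Y_def by (rule LeastI)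
  have Y1: "Y \<noteq> 0" "Y \<noteq> 1" using Y kn by (auto intro: Nat.gr0I)
  define y where "y = Y - 1"
  have y: "0 < y" "Y = Suc y" using Y1 by (auto simp: y_def)
  have "\<not> n < 2 ^ 31 * k * y\<^sup>2" using not_less_Least[of y "\<lambda>y. n < 2 ^ 31 * k * y\<^sup>2"] y
    by (simp add: Y_def)
  then have size: "2 ^ 31 * k * y\<^sup>2 \<le> n" by (simp only: not_less)
  have "2 ^ 31 * k * Y\<^sup>2 \<le> 2 ^ 31 * k * (2 * y)\<^sup>2"
    using y by (intro mult_left_mono power_mono) auto
  also have "\<dots> = 2 ^ 33 * k * y\<^sup>2" by (simp add: power_mult_distrib)
  finally have upper: "n \<le> 2 ^ 33 * k * y\<^sup>2"
    by (rule less_imp_le[OF less_le_trans[OF Y]])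
  interpret structure_grid n w s t1 t2 enc adj_alg deg_alg k y d q "Q (Suc j)"
    by unfold_locales (rule y(1) k size d t(2) upper q' quiet[folded q_def])+
  define m where "m = q * (2 * (t1 + t2))"
  have "s * 2 ^ w + 1 \<le> 2 ^ (2 * d) * 2 ^ (a * d) + 1"
    using s w by (intro add_mono mult_mono power_increasing) auto
  also have "\<dots> \<le> 2 * 2 ^ (2 * d + a * d)"
    by (simp add: power_add)
  also have "\<dots> = 2 ^ (2 * d + a * d + 1)" by simp
  also have "\<dots> \<le> 2 ^ ((3 + a) * d)"
    using d(1) by (intro power_increasing) (auto simp: algebra_simps)
  finally have "(s * 2 ^ w + 1) ^ m \<le> (2 ^ ((3 + a) * d)) ^ m"
    by (rule power_mono) simp
  then have "((s * 2 ^ w + 1) ^ m)\<^sup>2 \<le> ((2 ^ ((3 + a) * d)) ^ m)\<^sup>2"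
    by (rule power_mono) simp
  also have "\<dots> = 2 ^ (2 * ((3 + a) * d * m))"
    by (simp only: power_mult[symmetric] ac_simps)
  finally have N: "((s * 2 ^ w + 1) ^ m)\<^sup>2 \<le> 2 ^ (2 * ((3 + a) * d * m))" .
  have "2 ^ (2 * k) * fact n \<le> 16 * 2 ^ (s * w) * ((s * 2 ^ w + 1) ^ m)\<^sup>2"
    using counting_bound by (simp only: m_def)
  also have "\<dots> \<le> 16 * (2 ^ r * fact n) * 2 ^ (2 * ((3 + a) * d * m))"
    using r(2) N by (intro mult_mono) auto
  also have "\<dots> = 2 ^ (4 + r + 2 * ((3 + a) * d * m)) * fact n"
    by (simp add: power_add)
  finally have "(2 :: nat) ^ (2 * k) \<le> 2 ^ (4 + r + 2 * ((3 + a) * d * m))"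
    by (rule mult_right_le_imp_le) simp
  then have "2 * k \<le> 4 + r + 2 * ((3 + a) * d * m)"
    by (rule power_le_imp_le_exp[rotated]) simp
  moreover have "m \<le> q * (2 * d)"
    unfolding m_def using t by (intro mult_left_mono) auto
  then have "(3 + a) * d * m \<le> (3 + a) * d * (q * (2 * d))"
    by (rule mult_left_mono) simp
  moreover have "(3 + a) * d * (q * (2 * d)) = (6 + 2 * a) * (q * d\<^sup>2)"
    by (simp add: power2_eq_square algebra_simps)
  moreover have "2 * k = (20 + 4 * a) * (q * d\<^sup>2)"
    by (simp add: k_def algebra_simps)
  moreover have "(20 + 4 * a) * (q * d\<^sup>2) = 2 * ((6 + 2 * a) * (q * d\<^sup>2)) + 8 * (q * d\<^sup>2)"
    by (simp add: algebra_simps)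
  moreover have "q * 1 \<le> q * d\<^sup>2" using d(1) by (intro mult_left_mono) auto
  \<comment> \<open>The surplus \<open>8 * (q * d\<^sup>2)\<close> exceeds \<open>4 + r\<close>
    because \<open>1 \<le> r \<le> q\<close>.\<close>
  ultimately show False using rq r(1) by linarith
qed

text \<open>Without adjacency probes the answer for the vertices 1 and 2 would be the same for all
  inputs.\<close>

lemma probes_pos:
  assumes S: "interval_graph_structure n w s t1 t2 enc adj_alg deg_alg" and n: "2 \<le> n"
  shows "0 < t1 + t2"
proof (rule ccontr)
  assume "\<not> 0 < t1 + t2"
  then have t1: "t1 = 0" by simp
  define e\<^sub>1 e\<^sub>2 :: "nat \<Rightarrow> nat" where "e\<^sub>1 = (\<lambda>i\<in>{1..n}. i)" and "e\<^sub>2 = (\<lambda>i\<in>{1..n}. n)"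
  have e: "e\<^sub>1 \<in> universal_reps n" "e\<^sub>2 \<in> universal_reps n"
    by (auto simp: e\<^sub>1_def e\<^sub>2_def universal_reps_def)
  have v: "1 \<in> {1..n}" "2 \<in> {1..n}" using n by auto
  have a: "answers_within (adj_alg 1 2) (enc e) (adj e 1 2) 0" if "e \<in> universal_reps n" for e
    using S that v t1 by (simp add: interval_graph_structure_def)
  then have "probes (adj_alg 1 2) (enc e\<^sub>1) = []" using e by (simp add: answers_within_def)
  then obtain b where "adj_alg 1 2 = Answer b" by (cases "adj_alg 1 2") auto
  then have "adj e\<^sub>1 1 2 = adj e\<^sub>2 1 2"
    using a[OF e(1)] a[OF e(2)] by (simp add: answers_within_def)
  then show False
    using adj_iff[OF e(1) v] adj_iff[OF e(2) v] n by (simp add: e\<^sub>1_def e\<^sub>2_def)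
qed

text \<open>The encoding is injective, so \<open>r = 0\<close> would make \<open>fact n\<close> a
  power of two, although 3 divides it.\<close>

lemma redundancy_pos:
  assumes S: "interval_graph_structure n w s t1 t2 enc adj_alg deg_alg" and n: "3 \<le> n"
    and r: "2 ^ (s * w) \<le> 2 ^ r * (fact n :: nat)"
  shows "0 < r"
proof (rule ccontr)
  assume "\<not> 0 < r"
  with r have "2 ^ (s * w) \<le> (fact n :: nat)" by simp
  moreover have "card (enc ` universal_reps n) \<le> card (tables s w)"
    using S by (intro card_mono finite_tables) (auto simp: interval_graph_structure_def)
  then have "(fact n :: nat) \<le> 2 ^ (s * w)"
    using card_image[OF structure_inj_on[OF S]] by (simp add: card_universal_reps card_tables)
  ultimately have "(fact n :: nat) = 2 ^ (s * w)" by simp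
  moreover have "3 dvd (fact n :: nat)" using n by (intro dvd_fact) auto
  ultimately have "(3 :: nat) dvd 2 ^ (s * w)" by simp
  moreover have "coprime (3 :: nat) (2 ^ (s * w))"
    by (intro coprime_power_right_iff[THEN iffD2] disjI1) (simp add: coprime_iff_gcd_eq_1 gcd_nat.simps)
  ultimately show False using coprime_common_divisor[of 3 "2 ^ (s * w)" "3 :: nat"] by simp
qed

theorem theorem1:
  fixes w :: "nat \<Rightarrow> nat"
  assumes "(\<lambda>n. real (w n)) \<in> \<Theta>(\<lambda>n. log 2 (real n))"
  shows "\<exists>C>0. \<forall>n\<ge>3. \<forall>(s::nat) (r::nat) (t1::nat) (t2::nat) enc adj_alg deg_alg.
           interval_graph_structure n (w n) s t1 t2 enc adj_alg deg_alg \<longrightarrow>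
           real (s * w n) \<le> log 2 (fact n) + real r \<longrightarrow>
           real r \<ge> real n / (log 2 (real n)) powr (C * real (t1 + t2))"
proof -
  from assms have "(\<lambda>n. real (w n)) \<in> O(\<lambda>n. log 2 (real n))" by blast
  then obtain c\<^sub>1 where c\<^sub>1: "eventually (\<lambda>n. norm (real (w n)) \<le> c\<^sub>1 * norm (log 2 (real n))) at_top"
    by (elim landau_o.bigE)
  from assms have "(\<lambda>n. real (w n)) \<in> \<Omega>(\<lambda>n. log 2 (real n))" by blast
  then obtain c\<^sub>2 where c\<^sub>2: "0 < c\<^sub>2"
    "eventually (\<lambda>n. c\<^sub>2 * norm (log 2 (real n)) \<le> norm (real (w n))) at_top"
    by (elim landau_omega.bigE)
  define a where "a = nat \<lceil>c\<^sub>1\<rceil>"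
  \<comment> \<open>The base of the bound will be \<open>A * d ^ 4\<close>, which is at most the
    fifth power of the logarithm once \<open>16 * A \<le> log 2 n\<close>, as \<open>d\<close> is at
    most twice the logarithm.\<close>
  define A where "A = 2 ^ 40 * (2 * a + 10)"
  have "filterlim (\<lambda>n :: nat. log 2 (real n)) at_top at_top"
  proof -
    have "filterlim (\<lambda>n :: nat. (1 / ln 2) * ln (real n)) at_top at_top"
      by (rule filterlim_tendsto_pos_mult_at_top[OF tendsto_const _
            filterlim_compose[OF ln_at_top filterlim_real_sequentially]]) simp
    then show ?thesis by (simp add: log_def)
  qed
  then have "eventually (\<lambda>n. real (16 * A) \<le> log 2 (real n)) at_top"
    by (simp add: filterlim_at_top)
  with c\<^sub>1 c\<^sub>2(2) have "eventually (\<lambda>n. norm (real (w n)) \<le> c\<^sub>1 * norm (log 2 (real n)) \<and>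
      c\<^sub>2 * norm (log 2 (real n)) \<le> norm (real (w n)) \<and> real (16 * A) \<le> log 2 (real n)) at_top"
    by (intro eventually_conj)
  then obtain n\<^sub>0 where n\<^sub>0: "\<And>n. n\<^sub>0 \<le> n \<Longrightarrow> norm (real (w n)) \<le> c\<^sub>1 * norm (log 2 (real n))"
    "\<And>n. n\<^sub>0 \<le> n \<Longrightarrow> c\<^sub>2 * norm (log 2 (real n)) \<le> norm (real (w n))"
    "\<And>n. n\<^sub>0 \<le> n \<Longrightarrow> real (16 * A) \<le> log 2 (real n)"
    unfolding eventually_at_top_linorder by blast
  \<comment> \<open>The first entry is \<open>5 * T / t\<close>, from \<open>T\<close> levels with
    base at most \<open>L ^ 5\<close>. The second makes (3/2)^C at least \<open>n\<^sub>0\<close>,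
    which settles small \<open>n\<close> because \<open>L \<ge> 3 / 2\<close> and
    \<open>r \<ge> 1\<close>.\<close>
  define C :: real where "C = max (5 * 2 ^ 42) (log (3 / 2) (real (max 1 n\<^sub>0)))"
  have C: "0 < C" "5 * 2 ^ 42 \<le> C" by (auto simp: C_def)
  have "real n / (log 2 (real n)) powr (C * real (t1 + t2)) \<le> real r"
    if n3: "3 \<le> n" and S: "interval_graph_structure n (w n) s t1 t2 enc adj_alg deg_alg"
      and space: "real (s * w n) \<le> log 2 (fact n) + real r"
    for n s r t1 t2 enc adj_alg deg_alg
  proof -
    define L where "L = log 2 (real n)"
    define t where "t = t1 + t2"
    have t: "1 \<le> t" using probes_pos[OF S] n3 unfolding t_def by linarith
    have "2 powr (3 / 2) \<le> (3 :: real)"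
    proof -
      have "(2 powr (3 / 2))\<^sup>2 = (2 :: real) powr 3"
        by (simp add: power2_eq_square powr_add[symmetric])
      also have "\<dots> \<le> 3\<^sup>2" by simp
      finally show ?thesis by (rule power2_le_imp_le) simp
    qed
    also have "\<dots> \<le> real n" using n3 by simp
    finally have L: "3 / 2 \<le> L"
      unfolding L_def using n3 by (intro le_log_iff[THEN iffD2]) auto
    have "2 powr real (s * w n) \<le> 2 powr (log 2 (fact n) + real r)"
      using space by (intro powr_mono) auto
    also have "2 powr real (s * w n) = 2 ^ (s * w n)"
      by (rule powr_realpow) simp
    also have "2 powr (log 2 (fact n) + real r) = (2 :: real) ^ r * fact n"
      by (simp add: powr_add powr_realpow mult.commute)
    finally have "real (2 ^ (s * w n)) \<le> real (2 ^ r * fact n)" by simp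
    then have space': "2 ^ (s * w n) \<le> 2 ^ r * (fact n :: nat)"
      by (simp only: of_nat_le_iff)
    have r: "0 < r" by (rule redundancy_pos[OF S n3 space'])
    have Lpos: "0 < L powr (C * real t)" using L by simp
    have trivial: ?thesis if "real n \<le> L powr (C * real t)"
    proof -
      have "real n / L powr (C * real t) \<le> 1" using that Lpos by simp
      also have "\<dots> \<le> real r" using r by simp
      finally show ?thesis by (simp only: L_def t_def)
    qed
    show ?thesis
    proof (cases "n < n\<^sub>0")
      case True
      have "real n \<le> real (max 1 n\<^sub>0)" using True by simp
      also have "\<dots> = (3 / 2) powr (log (3 / 2) (real (max 1 n\<^sub>0)))" by simp
      also have "\<dots> \<le> (3 / 2) powr (C * real t)"
      proof (rule powr_mono)
        have "log (3 / 2) (real (max 1 n\<^sub>0)) \<le> C * 1" by (simp add: C_def)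
        also have "\<dots> \<le> C * real t" using C t by (intro mult_left_mono) auto
        finally show "log (3 / 2) (real (max 1 n\<^sub>0)) \<le> C * real t" .
      qed simp
      also have "\<dots> \<le> L powr (C * real t)" using L C by (intro powr_mono2) auto
      finally show ?thesis by (rule trivial)
    next
      case False
      then have n0: "n\<^sub>0 \<le> n" by simp
      define d where "d = nat \<lceil>L\<rceil>"
      have d: "L \<le> real d" "real d \<le> 2 * L" "0 < d" using L by (auto simp: d_def) linarith+
      have "real n = 2 powr L" using n3 by (simp add: L_def)
      also have "\<dots> \<le> 2 powr real d" using d(1) by (intro powr_mono) auto
      finally have "real n \<le> real (2 ^ d)" by (simp add: powr_realpow)
      then have nd: "n \<le> 2 ^ d" by (simp only: of_nat_le_iff)
      show ?thesis
      \<comment> \<open>If \<open>t > d\<close>, the denominator is already at least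
        \<open>n\<close>; if \<open>r \<ge> n\<close>, the claim is immediate. Otherwise
        \<open>r < n\<close> helps to bound the number of cells.\<close>
      proof (cases "t \<le> d \<and> r < n")
        case True
        have "real (w n) \<le> c\<^sub>1 * L" using n0 n\<^sub>0(1)[of n] L by (simp add: L_def)
        also have "\<dots> \<le> real a * real d"
          using d(1) L by (intro mult_mono) (auto simp: a_def, linarith)
        finally have "real (w n) \<le> real (a * d)" by simp
        then have w: "w n \<le> a * d" by (simp only: of_nat_le_iff)
        have "0 < c\<^sub>2 * L" using c\<^sub>2 L by simp
        also have "\<dots> \<le> real (w n)" using n0 n\<^sub>0(2)[of n] L by (simp add: L_def)
        finally have w0: "1 \<le> w n" by simp
        \<comment> \<open>A crude bound on \<open>s\<close>, polynomial in \<open>n\<close>, keeps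
          each published address within O(d) bits.\<close>
        have "log 2 (fact n) \<le> log 2 (real n ^ n)"
          using n3 fact_le_power[of n, where 'a = real] by simp
        also have "\<dots> = real n * L" using n3 by (simp add: L_def log_nat_power)
        also have "\<dots> \<le> real n * real d" using d(1) by (intro mult_left_mono) auto
        finally have "real (s * w n) \<le> real (n * d + n)" using space True by simp
        then have "s * w n \<le> n * (d + 1)" by (simp only: of_nat_le_iff) simp
        moreover have "s * 1 \<le> s * w n" using w0 by (rule mult_left_mono) simp
        ultimately have "s \<le> n * (d + 1)" by linarith
        also have "\<dots> \<le> 2 ^ d * 2 ^ d"
        proof (rule mult_mono[OF nd])
          have "d < (2 :: nat) ^ d" by (rule less_exp)
          then show "d + 1 \<le> 2 ^ d" by linarith
        qed auto
        finally have s: "s \<le> 2 ^ (2 * d)" by (simp add: mult_2 power_add)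
        define T where "T = 2 ^ 41 * (2 * t)"
        interpret interval_structure n "w n" s t1 t2 enc adj_alg deg_alg
          by unfold_locales (use S n3 in auto)
        have t': "0 < t1 + t2" "t1 + t2 \<le> d" using t True unfolding t_def by linarith+
        have "n < r * (A * d ^ 4) ^ T"
          unfolding T_def t_def
          by (rule redundancy_exceeds[OF t' d(3) nd w s r space']) (simp add: A_def)
        then have "real n < real (r * (A * d ^ 4) ^ T)" by (simp only: of_nat_less_iff)
        also have "\<dots> = real r * (real A * real d ^ 4) ^ T" by simp
        also have "\<dots> \<le> real r * (L ^ 5) ^ T"
        proof (intro mult_left_mono power_mono)
          have "real A * real d ^ 4 \<le> real A * (2 * L) ^ 4"
            using d(2) by (intro mult_left_mono power_mono) auto
          also have "\<dots> = real (16 * A) * L ^ 4" by (simp add: power_mult_distrib)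
          also have "\<dots> \<le> L * L ^ 4"
            using n\<^sub>0(3)[OF n0] L by (intro mult_right_mono) (auto simp: L_def)
          also have "\<dots> = L ^ 5" by (simp add: eval_nat_numeral)
          finally show "real A * real d ^ 4 \<le> L ^ 5" .
        qed auto
        also have "(L ^ 5) ^ T = L powr real (5 * T)"
          using L by (subst powr_realpow) (auto simp: power_mult)
        also have "\<dots> \<le> L powr (C * real t)"
        proof (rule powr_mono)
          have "real (5 * T) = 5 * 2 ^ 42 * real t" by (simp add: T_def)
          also have "\<dots> \<le> C * real t" by (rule mult_right_mono[OF C(2)]) simp
          finally show "real (5 * T) \<le> C * real t" .
        qed (use L in simp)
        finally have "real n \<le> real r * L powr (C * real t)" by (simp add: mult_left_mono)
        then have "real n / L powr (C * real t) \<le> real r" using Lpos by (simp add: divide_le_eq)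
        then show ?thesis by (simp only: L_def t_def)
      next
        case False
        then consider "d < t" | "n \<le> r" by linarith
        then show ?thesis
        proof cases
          case 1
          have "real (2 * 1) \<le> real (16 * A)" unfolding A_def by (simp only: of_nat_le_iff) simp
          also have "\<dots> \<le> L" using n\<^sub>0(3)[OF n0] by (simp only: L_def)
          finally have L2: "2 \<le> L" by simp
          have "real n \<le> 2 powr real d" using nd by (simp add: powr_realpow flip: of_nat_le_iff)
          also have "\<dots> \<le> 2 powr (C * real t)"
          proof (rule powr_mono)
            have "real d \<le> 1 * real t" using 1 by simp
            also have "\<dots> \<le> C * real t" using C(2) by (intro mult_right_mono) auto
            finally show "real d \<le> C * real t" .
          qed simp
          also have "\<dots> \<le> L powr (C * real t)" using L2 C(1) by (intro powr_mono2) auto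
          finally show ?thesis by (rule trivial)
        next
          case 2
          have "1 \<le> L powr (C * real t)" using L C(1) by (intro ge_one_powr_ge_zero) auto
          then have "real n / L powr (C * real t) \<le> real n"
            by (simp add: divide_le_eq mult_left_le[of 1] mult_le_cancel_left1)
          also have "\<dots> \<le> real r" using 2 by simp
          finally show ?thesis by (simp only: L_def t_def)
        qed
      qed
    qed
  qed
  then show ?thesis using C(1) by blast
qed

end
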